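(* Let $q$ be a power of a prime $p$, $A=\mathbb{F}_q[T]$, and let $\mathfrak{n}$ be a non-zero ideal of $A$. The left-kernel of the pairing $$\varphi_{\mathrm{HC},\mathbb{F}_p}:\mathbb{T}(\mathfrak{n},\mathbb{F}_p)\times\mathcal{H}_{0,0}(\mathfrak{n},\mathbb{F}_p)\to\mathbb{F}_p,\qquad(\theta,F)\mapsto c_1(\theta F),$$ contains the following elements: 1. for any $d\geq1$, $\sum_{\deg\mathfrak{p}\leq d}T_\mathfrak{p}$; 2. for any $d\geq2$, $\sum_{\deg\mathfrak{p}=d}T_\mathfrak{p}$. (Sums are over non-zero ideals $\mathfrak{p}$ of $A$ with the indicated degrees.)
   Context: **Basic notation.** $q$ is a power of a prime $p$, $A=\mathbb{F}_q[T]$, $A_+$ is the set of monic polynomials in $A$, $\pi=1/T$, $K_\infty=\mathbb{F}_q((\pi))$ with ring of integers $\mathcal{O}_\infty=\mathbb{F}_q[[\pi]]$. "Ideal of $A$" means non-zero ideal; its degree is the degree of its monic generator. $\Gamma_0(\mathfrak{n})=\{\left(\begin{smallmatrix}a&b\\c&d\end{smallmatrix}\right)\in \mathrm{GL}_2(A): c\in\mathfrak{n}\}$. For an ideal $\mathfrak{p}$ of $A$, let $S_\mathfrak{p}$ be the set of matrices $\left(\begin{smallmatrix}a&b\\0&d\end{smallmatrix}\right)$ with $a,d\in A_+$, $(ad)=\mathfrak{p}$, $(a)+\mathfrak{n}=A$, $b\in A$, $\deg b<\deg d$. The left-kernel of a pairing $\varphi:X\times Y\to R$ is $\{x\in X:\varphi(x,y)=0\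 \forall y\in Y\}$. **Harmonic cochains.** $\mathcal{T}$ is the Bruhat–Tits tree of $\mathrm{PGL}_2(K_\infty)$: vertices $V(\mathcal{T})=\mathrm{GL}_2(K_\infty)/K_\infty^\times\mathrm{GL}_2(\mathcal{O}_\infty)$, oriented edges $E(\mathcal{T})=\mathrm{GL}_2(K_\infty)/K_\infty^\times\mathcal{I}_\infty$ with $\mathcal{I}_\infty=\{\left(\begin{smallmatrix}a&b\\c&d\end{smallmatrix}\right)\in\mathrm{GL}_2(\mathcal{O}_\infty): c\equiv0\bmod\pi\}$; the edge $e$ represented by $g$ has origin $o(e)$ represented by $g$ and opposite edge $\overline e$ represented by $g\left(\begin{smallmatrix}0&1\\\pi&0\end{smallmatrix}\right)$. For a commutative ring $R$, an $R$-valued harmonic cochain is $F:E(\mathcal{T})\to R$ with $F(e)+F(\overline e)=0$ for all $e$ and $\sum_{o(e)=v}F(e)=0$ for all vertices $v$. $\mathcal{H}_0(\mathfrak{n},R)$ is the module of those that are $\Gamma_0(\mathfrak{n})$-invariant ($F(\gamma e)=F(e)$) and cuspidal (finitely supported as functions on the edges of $\Gamma_0(\mathfrak{n})\backslash\mathcal{T}$). $\mathcal{H}_{0,0}(\mathfrak{n},R)$ is the image of the canonical injective map $\mathcal{H}_0(\mathfrak{n},\mathbb{Z})\otimes_\mathbb{Z}R\to\mathcal{H}_0(\mathfrak{n},R)$. Hecke operators: $(T_\mathfrak{p}F)(e)=\sum_{g\in S_\mathfrak{p}}F(ge)$; they preserve $\mathcal{H}_{0,0}(\mathfrak{n},R)$.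 $\mathbb{T}(\mathfrak{n},\mathbb{F}_p)$ is the Hecke algebra over $\mathbb{F}_p$, i.e. the $\mathbb{F}_p$-subalgebra of $\mathrm{End}_{\mathbb{F}_p}(\mathcal{H}_{0,0}(\mathfrak{n},\mathbb{F}_p))$ generated by all $T_\mathfrak{p}$ (the paper defines it via the Hecke-equivariantly isomorphic space of weight-$2$ type-$1$ doubly cuspidal Drinfeld modular forms with residues in $\mathbb{F}_p$). **Fourier coefficient.** For $F\in\mathcal{H}_0(\mathfrak{n},\mathbb{C})$, the Fourier coefficient with respect to the trivial ideal is $c_1(F)=q^{-1}\sum_{u\in\pi\mathcal{O}_\infty/\pi^2\mathcal{O}_\infty}F\left(\left(\begin{smallmatrix}\pi^2&u\\0&1\end{smallmatrix}\right)\right)\eta(-u)$, where $\eta(\sum_k a_k\pi^k)=\eta_0(\mathrm{tr}_{\mathbb{F}_q/\mathbb{F}_p}(a_1))$ for a fixed non-trivial additive character $\eta_0:\mathbb{F}_p\to\mathbb{C}^\times$; it is known that $c_1(F)=-F\left(\left(\begin{smallmatrix}\pi^2&\pi\\0&1\end{smallmatrix}\right)\right)$, so $c_1$ is integer-valued on $\mathcal{H}_0(\mathfrak{n},\mathbb{Z})$. On $\mathcal{H}_{0,0}(\mathfrak{n},\mathbb{F}_p)=\mathcal{H}_0(\mathfrak{n},\mathbb{Z})\otimes\mathbb{F}_p$, $c_1$ denotes its reduction modulo $p$. *)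

theory Defs
  imports
    "HOL-Complex_Analysis.Laurent_Convergence"
    "HOL-Library.Function_Algebras"
begin

no_notation fps_nth (infixl \<open>$\<close> 75)

section \<open>Ideals of $A = \mathbb{F}_q[T]$\<close>

text \<open>
  Throughout, \<^typ>\<open>'a\<close> is the finite field $\mathbb{F}_q$, so $A$ is the type \<open>'a poly\<close>.
  An ideal of $A$ is a submodule of $A$ over itself.
\<close>

definition nonzero_ideal :: "'a::field poly set \<Rightarrow> bool" where
  "nonzero_ideal I \<longleftrightarrow> module.subspace (*) I \<and> I \<noteq> {0}"

definition principal_ideal :: "'a::field poly \<Rightarrow> 'a poly set" where
  "principal_ideal a = range ((*) a)"

definition monic :: "'a::field poly \<Rightarrow> bool" where
  "monic a \<longleftrightarrow> lead_coeff a = 1"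

definition ideal_degree :: "'a::field poly set \<Rightarrow> nat" where
  "ideal_degree I = degree (THE a. monic a \<and> I = principal_ideal a)"


section \<open>The place at infinity and matrix groups\<close>

text \<open>
  $K_\infty = \mathbb{F}_q((\pi))$ is the type \<open>'a fls\<close>, with $\pi$ = \<^const>\<open>fls_X\<close>.
\<close>

definition O_inf :: "'a::field fls set" where
  "O_inf = range fps_to_fls"

text \<open>The embedding $A \to K_\infty$, $T \mapsto \pi^{-1}$.\<close>

definition of_A :: "'a::field poly \<Rightarrow> 'a fls" where
  "of_A f = poly (map_poly fls_const f) fls_X_inv"

type_synonym 'a Kmat = "'a fls^2^2"

definition mat2 :: "'b \<Rightarrow> 'b \<Rightarrow> 'b \<Rightarrow> 'b \<Rightarrow> 'b::zero^2^2" where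
  "mat2 a b c d = vector [vector [a, b], vector [c, d]]"

text \<open>$\mathrm{GL}_2(S)$ for a subring $S$ of $K_\infty$; for $S = K_\infty$ this is \<^const>\<open>invertible\<close>.\<close>

definition GL2 :: "'a::field fls set \<Rightarrow> 'a Kmat set" where
  "GL2 S = {g. (\<forall>i j. g$i$j \<in> S) \<and>
     (\<exists>h. (\<forall>i j. h$i$j \<in> S) \<and> g ** h = mat 1 \<and> h ** g = mat 1)}"

definition iwahori :: "'a::field Kmat set" where
  "iwahori = {g \<in> GL2 O_inf. g$2$1 \<in> (*) fls_X ` O_inf}"

definition Gamma0 :: "'a::field poly set \<Rightarrow> 'a Kmat set" where
  "Gamma0 N = {g \<in> GL2 (range of_A). g$2$1 \<in> of_A ` N}"

lemma mat2_nth [simp]: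
  "mat2 a b c d $ 1 $ 1 = a" "mat2 a b c d $ 1 $ 2 = b"
  "mat2 a b c d $ 2 $ 1 = c" "mat2 a b c d $ 2 $ 2 = d"
  by (simp_all add: mat2_def)

lemma mat2_eq_iff:
  "(A :: 'b^2^2) = B \<longleftrightarrow> A$1$1 = B$1$1 \<and> A$1$2 = B$1$2 \<and> A$2$1 = B$2$1 \<and> A$2$2 = B$2$2"
  by (auto simp: vec_eq_iff forall_2)

lemma matmul2_nth:
  "((A :: 'b::semiring_1^2^2) ** B)$i$j = A$i$1 * B$1$j + A$i$2 * B$2$j"
  by (simp add: matrix_matrix_mult_def sum_2)

lemma mat_nth2 [simp]:
  "(mat z :: 'b::zero^2^2)$1$1 = z" "(mat z :: 'b^2^2)$1$2 = 0"
  "(mat z :: 'b^2^2)$2$1 = 0" "(mat z :: 'b^2^2)$2$2 = z"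
  by (simp_all add: mat_def)

lemma mat_commute2: "(mat z :: 'b::comm_semiring_1^2^2) ** (A :: 'b^2^2) = A ** mat z"
  by (simp add: mat2_eq_iff matmul2_nth mult.commute)

lemma mat_mult_mat2: "(mat z :: 'b::comm_semiring_1^2^2) ** mat w = mat (z * w)"
  by (simp add: mat2_eq_iff matmul2_nth)

lemma O_inf_closed [simp]:
  "0 \<in> O_inf" "1 \<in> O_inf"
  "x \<in> O_inf \<Longrightarrow> y \<in> O_inf \<Longrightarrow> x + y \<in> O_inf"
  "x \<in> O_inf \<Longrightarrow> y \<in> O_inf \<Longrightarrow> x - y \<in> O_inf"
  "x \<in> O_inf \<Longrightarrow> - x \<in> O_inf"
  "x \<in> O_inf \<Longrightarrow> y \<in> O_inf \<Longrightarrow> x * y \<in> O_inf"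
  "fls_X \<in> O_inf"
proof -
  show "0 \<in> O_inf" by (metis O_inf_def fps_zero_to_fls rangeI)
  show "1 \<in> O_inf" by (metis O_inf_def fps_one_to_fls rangeI)
  show "fls_X \<in> O_inf" by (metis O_inf_def fps_X_to_fls rangeI)
  show "x \<in> O_inf \<Longrightarrow> y \<in> O_inf \<Longrightarrow> x + y \<in> O_inf"
    by (auto simp: O_inf_def simp flip: fps_to_fls_plus)
  show "x \<in> O_inf \<Longrightarrow> y \<in> O_inf \<Longrightarrow> x - y \<in> O_inf"
    by (auto simp: O_inf_def simp flip: fps_to_fls_minus)
  show "x \<in> O_inf \<Longrightarrow> - x \<in> O_inf"
    by (auto simp: O_inf_def simp flip: fps_to_fls_uminus)
  show "x \<in> O_inf \<Longrightarrow> y \<in> O_inf \<Longrightarrow> x * y \<in> O_inf"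
    by (auto simp: O_inf_def simp flip: fls_times_fps_to_fls)
qed

lemma GL2_O_one: "mat 1 \<in> GL2 O_inf"
  unfolding GL2_def by (auto simp: forall_2 intro!: exI[of _ "mat 1"])

lemma GL2_O_mult:
  assumes "g \<in> GL2 O_inf" "h \<in> GL2 O_inf"
  shows "g ** h \<in> GL2 O_inf"
proof -
  obtain g' where g': "\<forall>i j. g'$i$j \<in> O_inf" "g ** g' = mat 1" "g' ** g = mat 1"
    using assms(1) by (auto simp: GL2_def)
  obtain h' where h': "\<forall>i j. h'$i$j \<in> O_inf" "h ** h' = mat 1" "h' ** h = mat 1"
    using assms(2) by (auto simp: GL2_def)
  have "(g ** h) ** (h' ** g') = mat 1"
    by (metis g'(2) h'(2) matrix_mul_assoc matrix_mul_rid)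
  moreover have "(h' ** g') ** (g ** h) = mat 1"
    by (metis g'(3) h'(3) matrix_mul_assoc matrix_mul_rid)
  moreover have "\<forall>i j. (h' ** g')$i$j \<in> O_inf" "\<forall>i j. (g ** h)$i$j \<in> O_inf"
    using g'(1) h'(1) assms by (auto simp: matmul2_nth GL2_def)
  ultimately show ?thesis unfolding GL2_def by blast
qed

lemma GL2_O_inverse:
  assumes "g \<in> GL2 O_inf"
  obtains h where "h \<in> GL2 O_inf" "g ** h = mat 1" "h ** g = mat 1"
  using assms by (auto simp: GL2_def)

lemma iwahori_one: "mat 1 \<in> iwahori"
  using O_inf_closed(1) by (force simp: iwahori_def GL2_O_one)

lemma iwahori_mult:
  assumes "g \<in> iwahori" "h \<in> iwahori"
  shows "g ** h \<in> iwahori"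
proof -
  obtain c where c: "c \<in> O_inf" "g$2$1 = fls_X * c" using assms by (auto simp: iwahori_def)
  obtain d where d: "d \<in> O_inf" "h$2$1 = fls_X * d" using assms by (auto simp: iwahori_def)
  have "(g ** h)$2$1 = fls_X * (c * h$1$1 + g$2$2 * d)"
    by (simp add: matmul2_nth c d algebra_simps)
  moreover have "c * h$1$1 + g$2$2 * d \<in> O_inf"
    using c d assms by (auto simp: iwahori_def GL2_def)
  ultimately show ?thesis using assms GL2_O_mult by (auto simp: iwahori_def)
qed

lemma iwahori_inverse:
  assumes "g \<in> iwahori"
  obtains h where "h \<in> iwahori" "g ** h = mat 1" "h ** g = mat 1"
proof -
  obtain c where c: "c \<in> O_inf" "g$2$1 = fls_X * c" using assms by (auto simp: iwahori_def)
  obtain h where h: "h \<in> GL2 O_inf" "g ** h = mat 1" "h ** g = mat 1"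
    using assms GL2_O_inverse by (auto simp: iwahori_def)
  have gh: "det g * det h = 1" using h(2) by (metis det_I det_mul)
  have 1: "h$2$1 * g$1$1 + h$2$2 * g$2$1 = 0" "h$2$1 * g$1$2 + h$2$2 * g$2$2 = 1"
    using h(3) by (simp_all add: mat2_eq_iff matmul2_nth)
  have "h$2$1 * det g = - g$2$1"
    using 1 unfolding det_2 by algebra
  hence "h$2$1 = - g$2$1 * det h"
    using gh by algebra
  hence "h$2$1 = fls_X * (- (c * det h))" by (simp add: c)
  moreover have "- (c * det h) \<in> O_inf"
    using c h by (auto simp: GL2_def det_2)
  ultimately have "h$2$1 \<in> (*) fls_X ` O_inf" by (rule image_eqI)
  with h that show thesis by (simp add: iwahori_def)
qed


section \<open>The Bruhat--Tits tree of $\mathrm{PGL}_2(K_\infty)$\<close>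

text \<open>
  The relation that defines $\mathrm{GL}_2(K_\infty)/K_\infty^\times U$ for a subgroup $U$, as a
  partial equivalence relation on all matrices.
\<close>

definition coset_rel :: "'a::field Kmat set \<Rightarrow> 'a Kmat \<Rightarrow> 'a Kmat \<Rightarrow> bool" where
  "coset_rel U g h \<longleftrightarrow> invertible g \<and> invertible h \<and>
     (\<exists>z k. z \<noteq> 0 \<and> k \<in> U \<and> h = g ** (mat z ** k))"

lemma part_equivp_coset_rel:
  assumes one: "mat 1 \<in> U" and mult: "\<And>g h. g \<in> U \<Longrightarrow> h \<in> U \<Longrightarrow> g ** h \<in> U"
    and inv: "\<And>g. g \<in> U \<Longrightarrow> \<exists>h\<in>U. g ** h = mat 1"
  shows "part_equivp (coset_rel U)"
proof (rule part_equivpI)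
  have "invertible (mat 1 :: 'a Kmat)"
    unfolding invertible_def by (metis matrix_mul_rid)
  thus "\<exists>x. coset_rel U x x"
    unfolding coset_rel_def using one by (metis matrix_mul_rid one_neq_zero)
  show "symp (coset_rel U)"
  proof (rule sympI)
    fix g h assume "coset_rel U g h"
    then obtain z k where zk: "invertible g" "invertible h" "z \<noteq> 0" "k \<in> U" "h = g ** (mat z ** k)"
      by (auto simp: coset_rel_def)
    obtain k' where k': "k' \<in> U" "k ** k' = mat 1" using inv zk by blast
    have "h ** (mat (inverse z) ** k') = g ** (mat z ** (k ** k') ** mat (inverse z))"
      unfolding zk mat_commute2[of "inverse z"] by (simp add: matrix_mul_assoc)
    also have "\<dots> = g"
      using zk by (simp add: k' mat_mult_mat2)
    finally show "coset_rel U h g"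
      unfolding coset_rel_def using zk k' by (metis inverse_nonzero_iff_nonzero)
  qed
  show "transp (coset_rel U)"
  proof (rule transpI)
    fix g h l assume "coset_rel U g h" "coset_rel U h l"
    then obtain z k w m where *: "invertible g" "invertible l" "z \<noteq> 0" "k \<in> U"
        "h = g ** (mat z ** k)" "w \<noteq> 0" "m \<in> U" "l = h ** (mat w ** m)"
      by (auto simp: coset_rel_def)
    have "l = g ** (mat z ** (k ** mat w) ** m)"
      by (simp add: * matrix_mul_assoc)
    also have "\<dots> = g ** (mat z ** mat w ** (k ** m))"
      unfolding mat_commute2[symmetric, of k] by (simp add: matrix_mul_assoc)
    finally have "l = g ** (mat (z * w) ** (k ** m))" by (simp add: mat_mult_mat2)
    thus "coset_rel U g l"
      unfolding coset_rel_def using * mult by (metis mult_eq_0_iff)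
  qed
qed

quotient_type (overloaded) 'a vertex = "'a::field Kmat" / partial: "coset_rel (GL2 O_inf)"
  by (rule part_equivp_coset_rel) (blast intro: GL2_O_one GL2_O_mult elim: GL2_O_inverse)+

quotient_type (overloaded) 'a edge = "'a::field Kmat" / partial: "coset_rel iwahori"
  by (rule part_equivp_coset_rel) (blast intro: iwahori_one iwahori_mult elim: iwahori_inverse)+

lift_definition origin :: "'a::field edge \<Rightarrow> 'a vertex" is "\<lambda>g. g"
  by (auto simp: coset_rel_def iwahori_def)

lift_definition opposite :: "'a::field edge \<Rightarrow> 'a edge" is "\<lambda>g. g ** mat2 0 1 fls_X 0"
proof -
  fix g h :: "'a Kmat" assume "coset_rel iwahori g h"
  then obtain z k where zk: "invertible g" "invertible h" "z \<noteq> 0" "k \<in> iwahori"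
    "h = g ** (mat z ** k)"
    by (auto simp: coset_rel_def)
  define w :: "'a Kmat" where "w = mat2 0 1 fls_X 0"
  define v :: "'a Kmat" where "v = mat2 0 fls_X_inv 1 0"
  have X: "fls_X * fls_X_inv = (1 :: 'a fls)" "fls_X_inv * fls_X = (1 :: 'a fls)"
    by (simp_all add: fls_X_times_conv_shift fls_X_inv_times_conv_shift)
  have wv: "w ** v = mat 1" "v ** w = mat 1"
    by (simp_all add: w_def v_def mat2_eq_iff matmul2_nth X)
  have iw: "v ** m ** w \<in> iwahori" if m: "m \<in> iwahori" for m
  proof -
    have ent: "(v ** k ** w)$1$1 = k$2$2" "(v ** k ** w)$1$2 = fls_X_inv * k$2$1"
      "(v ** k ** w)$2$1 = fls_X * k$1$2" "(v ** k ** w)$2$2 = k$1$1" for k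
    proof -
      have "fls_X_inv * k$2$2 * fls_X = k$2$2"
        using X(2) by algebra
      thus "(v ** k ** w)$1$1 = k$2$2" by (simp add: v_def w_def matmul2_nth)
    qed (simp_all add: v_def w_def matmul2_nth mult.commute)
    have ent_O: "\<forall>i j. (v ** k ** w)$i$j \<in> O_inf" if k: "k \<in> iwahori" for k
    proof -
      obtain c where c: "c \<in> O_inf" "k$2$1 = fls_X * c" using k by (auto simp: iwahori_def)
      have "fls_X_inv * k$2$1 = c" by (simp add: c X mult.assoc[symmetric])
      thus ?thesis using c(1) k by (simp add: forall_2 ent iwahori_def GL2_def)
    qed
    obtain m' where m': "m' \<in> iwahori" "m ** m' = mat 1" "m' ** m = mat 1"
      using iwahori_inverse[OF m] .
    have "(v ** a ** w) ** (v ** b ** w) = mat 1" if "a ** b = mat 1" for a b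
    proof -
      have "(v ** a ** w) ** (v ** b ** w) = v ** (a ** (w ** v) ** b) ** w"
        by (simp only: matrix_mul_assoc)
      thus ?thesis using that wv by simp
    qed
    from this[OF m'(2)] this[OF m'(3)] have "v ** m ** w \<in> GL2 O_inf"
      unfolding GL2_def using ent_O[OF m] ent_O[OF m'(1)] by blast
    moreover have "(v ** m ** w)$2$1 \<in> (*) fls_X ` O_inf"
      using m by (auto simp: ent iwahori_def GL2_def)
    ultimately show ?thesis by (simp add: iwahori_def)
  qed
  have "h ** w = g ** (mat z ** (w ** v) ** k) ** w"
    by (simp add: wv zk)
  also have "\<dots> = g ** (mat z ** w) ** (v ** k ** w)"
    by (simp only: matrix_mul_assoc)
  also have "\<dots> = (g ** w) ** (mat z ** (v ** k ** w))"
    unfolding mat_commute2[of z w] by (simp only: matrix_mul_assoc)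
  finally have hw: "h ** w = (g ** w) ** (mat z ** (v ** k ** w))" .
  have "invertible w" unfolding invertible_def using wv by blast
  hence "invertible (g ** w)" "invertible (h ** w)"
    using zk(1,2) by (simp_all only: invertible_mult)
  moreover have "v ** k ** w \<in> iwahori" using iw[OF zk(4)] .
  ultimately show "coset_rel iwahori (g ** mat2 0 1 fls_X 0) (h ** mat2 0 1 fls_X 0)"
    unfolding coset_rel_def w_def[symmetric] using zk(3) hw by blast
qed

text \<open>The left action of $\mathrm{GL}_2(K_\infty)$, only used for invertible \<^term>\<open>g\<close>.\<close>

definition act :: "'a::field Kmat \<Rightarrow> 'a edge \<Rightarrow> 'a edge" where
  "act g e = abs_edge (g ** rep_edge e)"

lemma coset_rel_iwahori_refl: "invertible g \<Longrightarrow> coset_rel iwahori g g"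
  unfolding coset_rel_def using iwahori_one by (metis matrix_mul_rid one_neq_zero)

lemma act_abs_edge:
  assumes "invertible g" "invertible x"
  shows "act g (abs_edge x) = abs_edge (g ** x)"
proof -
  have "coset_rel iwahori x (rep_edge (abs_edge x))"
    using Quotient3_edge coset_rel_iwahori_refl[OF assms(2)]
    by (meson rep_abs_rsp)
  then obtain z k where "z \<noteq> 0" "k \<in> iwahori" "invertible (rep_edge (abs_edge x))"
    "rep_edge (abs_edge x) = x ** (mat z ** k)"
    unfolding coset_rel_def by blast
  moreover from this have "g ** rep_edge (abs_edge x) = (g ** x) ** (mat z ** k)"
    by (simp only: matrix_mul_assoc)
  ultimately have "coset_rel iwahori (g ** x) (g ** rep_edge (abs_edge x))"
    unfolding coset_rel_def using assms invertible_mult by blast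
  from Quotient3_rel_abs[OF Quotient3_edge this] show ?thesis
    unfolding act_def by (rule sym)
qed


section \<open>Harmonic cochains and Hecke operators\<close>

definition harmonic :: "('a::field edge \<Rightarrow> 'r::comm_ring_1) \<Rightarrow> bool" where
  "harmonic F \<longleftrightarrow> (\<forall>e. F e + F (opposite e) = 0) \<and> (\<forall>v. (\<Sum>e | origin e = v. F e) = 0)"

definition orbit :: "'a::field poly set \<Rightarrow> 'a edge \<Rightarrow> 'a edge set" where
  "orbit N e = (\<lambda>g. act g e) ` Gamma0 N"

definition H0 :: "'a::field poly set \<Rightarrow> ('a edge \<Rightarrow> 'r::comm_ring_1) set" where
  "H0 N = {F. harmonic F \<and> (\<forall>g\<in>Gamma0 N. \<forall>e. F (act g e) = F e) \<and>
              finite (orbit N ` {e. F e \<noteq> 0})}"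

text \<open>
  The image of $\mathcal{H}_0(\mathfrak{n},\mathbb{Z}) \otimes R \to \mathcal{H}_0(\mathfrak{n},R)$:
  the image of the tensor $\sum_i F_i \otimes r_i$ is $e \mapsto \sum_i r_i F_i(e)$.
\<close>

definition H00 :: "'a::field poly set \<Rightarrow> ('a edge \<Rightarrow> 'r::comm_ring_1) set" where
  "H00 N = {G. \<exists>(m::nat) r F. (\<forall>i<m. F i \<in> H0 N) \<and>
                 G = (\<lambda>e. \<Sum>i<m. r i * of_int (F i e))}"

text \<open>
  In \<^term>\<open>b = 0 \<or> degree b < degree d\<close> the first disjunct is the convention
  $\deg 0 = -\infty$; in the library \<^term>\<open>degree 0 = 0\<close>.
\<close>

definition S_mats :: "'a::field poly set \<Rightarrow> 'a poly set \<Rightarrow> 'a Kmat set" where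
  "S_mats N P = {mat2 (of_A a) (of_A b) 0 (of_A d) | a b d.
     monic a \<and> monic d \<and> principal_ideal (a * d) = P \<and>
     {x + y | x y. x \<in> principal_ideal a \<and> y \<in> N} = UNIV \<and>
     (b = 0 \<or> degree b < degree d)}"

definition hecke :: "'a::field poly set \<Rightarrow> 'a poly set \<Rightarrow>
    ('a edge \<Rightarrow> 'r::comm_ring_1) \<Rightarrow> ('a edge \<Rightarrow> 'r)" where
  "hecke N P F = (\<lambda>e. \<Sum>g\<in>S_mats N P. F (act g e))"

text \<open>
  An endomorphism of $\mathcal{H}_{0,0}(\mathfrak{n},R)$ is represented by the function that extends
  it by zero to all functions on edges. Sums and compositions of endomorphisms are then the sums
  and compositions of these functions, and the unit is the extension of the identity.
\<close>

definition on_H00 :: "'a::field poly set \<Rightarrow> (('a edge \<Rightarrow> 'r::comm_ring_1) \<Rightarrow> ('a edge \<Rightarrow> 'r)) \<Rightarrow>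
    (('a edge \<Rightarrow> 'r) \<Rightarrow> ('a edge \<Rightarrow> 'r))" where
  "on_H00 N \<theta> = (\<lambda>F. if F \<in> H00 N then \<theta> F else 0)"

definition T_op :: "'a::field poly set \<Rightarrow> 'a poly set \<Rightarrow>
    (('a edge \<Rightarrow> 'r::comm_ring_1) \<Rightarrow> ('a edge \<Rightarrow> 'r))" where
  "T_op N P = on_H00 N (hecke N P)"

inductive_set hecke_algebra ::
    "'a::field poly set \<Rightarrow> (('a edge \<Rightarrow> 'r::comm_ring_1) \<Rightarrow> ('a edge \<Rightarrow> 'r)) set"
  for N :: "'a poly set" where
  one: "on_H00 N (\<lambda>F. F) \<in> hecke_algebra N"
| gen: "nonzero_ideal P \<Longrightarrow> T_op N P \<in> hecke_algebra N"
| add: "\<theta> \<in> hecke_algebra N \<Longrightarrow> \<theta>' \<in> hecke_algebra N \<Longrightarrow> \<theta> + \<theta>' \<in> hecke_algebra N"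
| scale: "\<theta> \<in> hecke_algebra N \<Longrightarrow> (\<lambda>F e. c * \<theta> F e) \<in> hecke_algebra N"
| comp: "\<theta> \<in> hecke_algebra N \<Longrightarrow> \<theta>' \<in> hecke_algebra N \<Longrightarrow> \<theta> \<circ> \<theta>' \<in> hecke_algebra N"


section \<open>The Fourier coefficient and the pairing\<close>

text \<open>
  The field $\mathbb{F}_p$ is a type \<^typ>\<open>'f\<close> with $p$ elements. The trace
  $\mathrm{tr}_{\mathbb{F}_q/\mathbb{F}_p}(x) = \sum_{i<r} x^{p^i}$, $q = p^r$, lies in the prime
  field of \<^typ>\<open>'a\<close>, which is identified with \<^typ>\<open>'f\<close> by \<open>of_int k \<mapsto> of_int k\<close>.
\<close>

definition prime_degree :: "'a::finite_field itself \<Rightarrow> nat" where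
  "prime_degree _ = (THE r. CARD('a) = CHAR('a) ^ r)"

definition trace_Fp :: "'a::finite_field \<Rightarrow> 'f::finite_field" where
  "trace_Fp x = (THE y. \<exists>k::int. y = of_int k \<and>
     of_int k = (\<Sum>i<prime_degree TYPE('a). x ^ (CHAR('a) ^ i)))"

definition nontrivial_additive_character :: "('f::finite_field \<Rightarrow> complex) \<Rightarrow> bool" where
  "nontrivial_additive_character \<eta>\<^sub>0 \<longleftrightarrow>
     (\<forall>x. \<eta>\<^sub>0 x \<noteq> 0) \<and> (\<forall>x y. \<eta>\<^sub>0 (x + y) = \<eta>\<^sub>0 x * \<eta>\<^sub>0 y) \<and> (\<exists>x. \<eta>\<^sub>0 x \<noteq> 1)"

definition eta :: "('f::finite_field \<Rightarrow> complex) \<Rightarrow> 'a::finite_field fls \<Rightarrow> complex" where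
  "eta \<eta>\<^sub>0 x = \<eta>\<^sub>0 (trace_Fp (fls_nth x 1))"

text \<open>
  The elements $a\pi$ with $a \in \mathbb{F}_q$ represent
  $\pi\mathcal{O}_\infty/\pi^2\mathcal{O}_\infty$.
\<close>

definition c1 :: "('f::finite_field \<Rightarrow> complex) \<Rightarrow> ('a::finite_field edge \<Rightarrow> complex) \<Rightarrow> complex" where
  "c1 \<eta>\<^sub>0 F = inverse (of_nat CARD('a)) *
     (\<Sum>u\<in>(\<lambda>a. fls_const a * fls_X) ` UNIV.
        F (abs_edge (mat2 (fls_X ^ 2) u 0 1)) * eta \<eta>\<^sub>0 (- u))"

definition c1_int :: "('f::finite_field \<Rightarrow> complex) \<Rightarrow> ('a::finite_field edge \<Rightarrow> int) \<Rightarrow> int" where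
  "c1_int \<eta>\<^sub>0 F = (THE m. of_int m = c1 \<eta>\<^sub>0 (\<lambda>e. of_int (F e)))"

text \<open>
  The coefficient $c_1$ on $\mathcal{H}_{0,0}(\mathfrak{n},\mathbb{F}_p)$: lift to
  $\mathcal{H}_0(\mathfrak{n},\mathbb{Z})$, apply $c_1$ and reduce modulo $p$.
\<close>

definition c1_mod :: "('f::finite_field \<Rightarrow> complex) \<Rightarrow> 'a::finite_field poly set \<Rightarrow>
    ('a edge \<Rightarrow> 'f) \<Rightarrow> 'f" where
  "c1_mod \<eta>\<^sub>0 N G = (THE x. \<exists>F\<in>H0 N. G = (\<lambda>e. of_int (F e)) \<and> x = of_int (c1_int \<eta>\<^sub>0 F))"

definition pairing_HC :: "('f::finite_field \<Rightarrow> complex) \<Rightarrow> 'a::finite_field poly set \<Rightarrow>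
    (('a edge \<Rightarrow> 'f) \<Rightarrow> ('a edge \<Rightarrow> 'f)) \<Rightarrow> ('a edge \<Rightarrow> 'f) \<Rightarrow> 'f" where
  "pairing_HC \<eta>\<^sub>0 N \<theta> F = c1_mod \<eta>\<^sub>0 N (\<theta> F)"

definition left_kernel :: "'x set \<Rightarrow> 'y set \<Rightarrow> ('x \<Rightarrow> 'y \<Rightarrow> 'r::zero) \<Rightarrow> 'x set" where
  "left_kernel X Y \<phi> = {x \<in> X. \<forall>y\<in>Y. \<phi> x y = 0}"

end

theory Submission
  imports Defs
begin

text \<open>
  Write $F(\pi^k, y)$ for the value of a cuspidal cochain at the edge of the upper triangular matrix
  with diagonal $(\pi^k, 1)$ and upper right entry $y$. Then $c_1(F) = -F(\pi^2, \pi)$. In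
  $(T_\mathfrak{p} F)(\pi^2, \pi)$ the terms with $a \neq 1$ cancel: by harmonicity they add up to
  multiples of values close to the cusp $\infty$, which vanish. For $\mathfrak{p} = (m)$ with $m$ monic
  of degree $j$ the terms with $a = 1$ are the $F(\pi^{j+2}, u)$ over all $u \in \pi O_\infty/\pi^{j+2}$
  such that the coefficient of $\pi$ in $um$ is 1. Summing over $m$, each value is taken as often as
  there are monic $m$ of degree $j$ with this affine linear condition, and for $j \ge 2$ this number is
  divisible by $q$. Modulo $q$ the degrees 0 and 1 contribute $F(\pi^2, \pi)$ and
  $(q - 1) F(\pi^2, \pi)$.
\<close>

section \<open>The embedding of $A$ and the filtration of $K_\infty$\<close>

text \<open>All computations take place over the integers, with divisibility by q, and reduction
  modulo p comes last: the vanishing near the cusp compares growth by powers of q with a finite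
  range of values, and over F_p multiplication by q is 0. The price is that \<open>c1_mod\<close> is
  defined through a lift to H_0(n, Z), so a Hecke sum of an integral cochain must itself be shown to
  lie in H_0(n, Z). Invariance holds because S_p is a set of representatives modulo Gamma_0(n);
  cuspidality follows from a finiteness argument with matrices of determinant m, up to units, taken
  modulo m n. The terms with deg a = i > 0 cancel because summation over b modulo d collapses level
  2 - i + deg d to level 1, unless this level is already at most 1. A monic m of degree j has j free
  coefficients against one affine equation: from j = 2 on this leaves a whole direction of
  solutions, while for j = 1 the solution may be unique, which is why degree 1 alone is not in the
  kernel argument and has to be paired with degree 0. The trace and the character enter only through
  the formula for c_1.\<close>

lemma of_A_0 [simp]: "of_A 0 = 0"
  by (simp add: of_A_def)

lemma of_A_pCons: "of_A (pCons c f) = fls_const c + fls_X_inv * of_A (f :: 'a::field poly)"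
  by (simp add: of_A_def map_poly_pCons)

lemma of_A_add: "of_A (f + g) = of_A f + of_A (g :: 'a::field poly)"
  by (induction f g rule: poly_induct2) (simp_all add: of_A_pCons algebra_simps fls_plus_const[symmetric])

lemma of_A_smult: "of_A (smult c f) = fls_const c * of_A (f :: 'a::field poly)"
  by (induction f) (simp_all add: of_A_pCons algebra_simps)

lemma of_A_mult: "of_A (f * g) = of_A f * of_A (g :: 'a::field poly)"
  by (induction f) (simp_all add: of_A_pCons of_A_add of_A_smult algebra_simps)

lemma of_A_const: "of_A [:c:] = fls_const (c :: 'a::field)"
  by (simp add: of_A_pCons)

lemma of_A_1 [simp]: "of_A 1 = (1 :: 'a::field fls)"
  using of_A_const[of "1 :: 'a"] by (simp add: one_pCons)

lemma of_A_minus: "of_A (- f) = - of_A (f :: 'a::field poly)"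
  using of_A_add[of f "- f"] by (simp add: add_eq_0_iff)

lemma of_A_diff: "of_A (f - g) = of_A f - of_A (g :: 'a::field poly)"
  using of_A_add[of f "- g"] by (simp add: of_A_minus)

lemma of_A_monom: "of_A (monom c n) = fls_const c * fls_X_intpow (- int n)"
  for c :: "'a::field"
proof (induction n)
  case (Suc n)
  have "fls_X_inv * fls_X_intpow (- int n) = (fls_X_intpow (- int (Suc n)) :: 'a fls)"
    by (simp add: fls_X_inv_times_conv_shift)
  then show ?case
    using Suc by (simp add: monom_Suc of_A_pCons mult.left_commute)
qed (simp add: of_A_const monom_0)

lemma fls_nth_of_A: "fls_nth (of_A f) n = (if n \<le> 0 then coeff f (nat (- n)) else 0)"
  for f :: "'a::field poly"
proof (induction f arbitrary: n)
  case (pCons c f)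
  then show ?case
  proof (cases "n < 0")
    case True
    then have "nat (- n) = Suc (nat (- (n + 1)))" by simp
    then show ?thesis
      using True pCons.IH[of "n + 1"] by (simp add: of_A_pCons fls_X_inv_times_conv_shift)
  next
    case False
    then show ?thesis
      using pCons.IH[of "n + 1"] by (auto simp: of_A_pCons fls_X_inv_times_conv_shift)
  qed
qed simp

lemma inj_of_A: "inj (of_A :: 'a::field poly \<Rightarrow> _)"
proof
  fix f g :: "'a poly" assume "of_A f = of_A g"
  then have "coeff f n = coeff g n" for n
    using fls_nth_of_A[of f "- int n"] fls_nth_of_A[of g "- int n"] by simp
  then show "f = g" by (simp add: poly_eqI)
qed

lemma of_A_eq_iff [simp]: "of_A f = of_A g \<longleftrightarrow> f = (g :: 'a::field poly)"
  using inj_of_A by (auto dest: injD)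

lemma of_A_eq_0_iff [simp]: "of_A f = 0 \<longleftrightarrow> f = (0 :: 'a::field poly)"
  using of_A_eq_iff[of f 0] by simp

lemma fls_subdegree_of_A: "f \<noteq> 0 \<Longrightarrow> fls_subdegree (of_A f) = - int (degree (f :: 'a::field poly))"
  by (rule fls_subdegree_eqI) (auto simp: fls_nth_of_A coeff_eq_0)

text \<open>The fractional ideal pi^k O_inf. Vanishing coefficients treat 0 uniformly, whereas
  \<open>fls_subdegree 0\<close> is 0 and would force case distinctions.\<close>

definition pi_ideal :: "int \<Rightarrow> 'a::field fls set" where
  "pi_ideal k = {x. \<forall>n<k. fls_nth x n = 0}"

lemma pi_ideal_iff: "x \<in> pi_ideal k \<longleftrightarrow> x = 0 \<or> k \<le> fls_subdegree x"
  by (auto simp: pi_ideal_def intro: fls_subdegree_geI)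

lemma pi_ideal_closed [simp]:
  "0 \<in> pi_ideal k"
  "x \<in> pi_ideal k \<Longrightarrow> y \<in> pi_ideal k \<Longrightarrow> x + y \<in> pi_ideal k"
  "x \<in> pi_ideal k \<Longrightarrow> y \<in> pi_ideal k \<Longrightarrow> x - y \<in> pi_ideal k"
  "x \<in> pi_ideal k \<Longrightarrow> - x \<in> pi_ideal k"
  by (auto simp: pi_ideal_def)

lemma pi_ideal_antimono: "x \<in> pi_ideal k \<Longrightarrow> l \<le> k \<Longrightarrow> x \<in> pi_ideal l"
  by (auto simp: pi_ideal_def)

lemma pi_ideal_SucI: "x \<in> pi_ideal k \<Longrightarrow> fls_nth x k = 0 \<Longrightarrow> x \<in> pi_ideal (k + 1)"
  by (auto simp: pi_ideal_def order_le_less)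

lemma pi_ideal_mult: "x \<in> pi_ideal k \<Longrightarrow> y \<in> pi_ideal l \<Longrightarrow> x * y \<in> pi_ideal (k + l)"
  for x y :: "'a::field fls"
  by (cases "x = 0 \<or> y = 0") (auto simp: pi_ideal_iff)

lemma pi_ideal_divide:
  "x \<in> pi_ideal k \<Longrightarrow> y \<noteq> 0 \<Longrightarrow> x / y \<in> pi_ideal (k - fls_subdegree (y :: 'a::field fls))"
  by (cases "x = 0") (auto simp: pi_ideal_iff divide_inverse fls_inverse_subdegree)

lemma intpow_in_pi_ideal: "k \<le> l \<Longrightarrow> fls_X_intpow l \<in> pi_ideal k"
  by (auto simp: pi_ideal_iff)

lemma const_in_pi_ideal: "k \<le> 0 \<Longrightarrow> fls_const c \<in> pi_ideal k"
  by (auto simp: pi_ideal_def)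

lemma of_A_in_pi_ideal: "of_A f \<in> pi_ideal (- int (degree (f :: 'a::field poly)))"
  by (cases "f = 0") (auto simp: pi_ideal_iff fls_subdegree_of_A)

lemma O_inf_eq: "O_inf = pi_ideal 0"
proof safe
  fix x :: "'a fls" assume "x \<in> O_inf"
  then show "x \<in> pi_ideal 0" by (auto simp: O_inf_def pi_ideal_def)
next
  fix x :: "'a fls" assume "x \<in> pi_ideal 0"
  then have "x = fps_to_fls (fls_regpart x)"
    by (intro fls_eqI) (auto simp: pi_ideal_def)
  then show "x \<in> O_inf" unfolding O_inf_def by blast
qed

lemma X_O_inf_eq: "(*) fls_X ` O_inf = pi_ideal 1"
proof safe
  fix x :: "'a fls" assume "x \<in> O_inf"
  then show "fls_X * x \<in> pi_ideal 1"
    by (auto simp: O_inf_eq pi_ideal_def fls_X_times_conv_shift)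
next
  fix x :: "'a fls" assume "x \<in> pi_ideal 1"
  then have "fls_shift 1 x \<in> O_inf" "x = fls_X * fls_shift 1 x"
    by (auto simp: O_inf_eq pi_ideal_def fls_X_times_conv_shift)
  then show "x \<in> (*) fls_X ` O_inf" by blast
qed

text \<open>The coefficients at nonpositive powers of pi are finitely many and form a polynomial in
  T = 1/pi. Hence translations by A can move any upper right entry into pi O_inf.\<close>

lemma ex_of_A_approx: "\<exists>f. x - of_A f \<in> pi_ideal 1" for x :: "'a::field fls"
proof -
  define f where "f = (\<Sum>i\<le>nat (- fls_subdegree x). monom (fls_nth x (- int i)) i)"
  have "fls_nth (x - of_A f) n = 0" if "n < 1" for n
  proof -
    have "coeff f (nat (- n)) = (if nat (-n) \<le> nat (- fls_subdegree x) then fls_nth x n else 0)"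
      using that by (simp add: f_def coeff_sum coeff_monom if_distrib sum.delta' cong: if_cong)
    then show ?thesis using that by (auto simp: fls_nth_of_A)
  qed
  then show ?thesis by (auto simp: pi_ideal_def)
qed

section \<open>Ideals of $A$\<close>

lemma nonzero_ideal_iff:
  "nonzero_ideal (I :: 'a::field poly set) \<longleftrightarrow>
     0 \<in> I \<and> (\<forall>x\<in>I. \<forall>y\<in>I. x + y \<in> I) \<and> (\<forall>c. \<forall>x\<in>I. c * x \<in> I) \<and> I \<noteq> {0}"
proof -
  have "Modules.module ((*) :: 'a poly \<Rightarrow> _)"
    by unfold_locales (auto simp: algebra_simps)
  then show ?thesis by (simp add: nonzero_ideal_def module.subspace_def)
qed

lemma mem_principal_ideal: "x \<in> principal_ideal a \<longleftrightarrow> a dvd x"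
  by (auto simp: principal_ideal_def dvd_def)

lemma monic_nonzero: "monic a \<Longrightarrow> a \<noteq> (0 :: 'a::field poly)"
  by (auto simp: monic_def)

lemma monic_mult: "monic a \<Longrightarrow> monic b \<Longrightarrow> monic (a * b)" for a :: "'a::field poly"
  by (simp add: monic_def lead_coeff_mult)

lemma nonzero_ideal_principal:
  "a \<noteq> 0 \<Longrightarrow> nonzero_ideal (principal_ideal (a :: 'a::field poly))"
proof -
  assume "a \<noteq> 0"
  moreover have "a \<in> principal_ideal a" by (simp add: mem_principal_ideal)
  ultimately have "principal_ideal a \<noteq> {0}" by blast
  then show ?thesis by (simp add: nonzero_ideal_iff mem_principal_ideal)
qed

lemma principal_ideal_inj:
  assumes "monic a" "monic b" "principal_ideal a = principal_ideal (b :: 'a::field poly)"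
  shows "a = b"
proof -
  have "a dvd b" "b dvd a" using assms(3) by (metis dvd_refl mem_principal_ideal)+
  then obtain c where c: "b = a * c" and "degree b \<le> degree a"
    using assms(1) monic_nonzero by (blast intro: dvd_imp_degree_le)
  moreover have "a \<noteq> 0" "c \<noteq> 0" using assms(1,2) c by (auto dest: monic_nonzero)
  ultimately obtain k where "c = [:k:]" by (auto simp: degree_mult_eq elim: degree_eq_zeroE)
  then show ?thesis using assms(1,2) c by (auto simp: monic_def split: if_splits)
qed

lemma nonzero_ideal_generator:
  assumes "nonzero_ideal (I :: 'a::field poly set)"
  obtains a where "monic a" "I = principal_ideal a"
proof -
  have "\<exists>x. x \<in> I \<and> x \<noteq> 0" using assms by (auto simp: nonzero_ideal_iff)
  then obtain x where x: "x \<in> I" "x \<noteq> 0" "\<And>y. y \<in> I \<Longrightarrow> y \<noteq> 0 \<Longrightarrow> degree x \<le> degree y"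
    using ex_has_least_nat[of "\<lambda>x. x \<in> I \<and> x \<noteq> 0" _ degree] by blast
  define a where "a = smult (inverse (lead_coeff x)) x"
  have "monic a" using x by (simp add: a_def monic_def)
  moreover have "I = principal_ideal a"
  proof safe
    fix y assume y: "y \<in> I"
    have "y mod x = y + (- (y div x)) * x" by (simp add: minus_div_mult_eq_mod[symmetric])
    also have "\<dots> \<in> I" using assms x y unfolding nonzero_ideal_iff by blast
    finally have "y mod x = 0"
      using x(3) degree_mod_less[of x y] x(2) by force
    then have "x dvd y" by auto
    then show "y \<in> principal_ideal a"
      using x(2) by (simp add: mem_principal_ideal a_def smult_dvd_iff)
  next
    fix y assume "y \<in> principal_ideal a"
    then have "x dvd y" using x(2) by (simp add: mem_principal_ideal a_def smult_dvd_iff)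
    then show "y \<in> I" using assms x by (auto simp: nonzero_ideal_iff dvd_def mult.commute)
  qed
  ultimately show thesis using that by blast
qed

lemma ideal_degree_principal: "monic a \<Longrightarrow> ideal_degree (principal_ideal a) = degree (a :: 'a::field poly)"
  unfolding ideal_degree_def using principal_ideal_inj by (metis (mono_tags, lifting) the_equality)

text \<open>The predicate \<open>R\<close> lets one bijection serve both the sums over degree
  exactly d and those over degree at most d.\<close>

lemma bij_betw_principal_ideal:
  "bij_betw principal_ideal {m. monic m \<and> R (degree m)}
     {P :: 'a::field poly set. nonzero_ideal P \<and> R (ideal_degree P)}"
  unfolding bij_betw_def
proof safe
  show "inj_on principal_ideal {m :: 'a poly. monic m \<and> R (degree m)}"
    by (auto intro!: inj_onI principal_ideal_inj)
next
  fix m :: "'a poly" assume "monic m" "R (degree m)"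
  then show "nonzero_ideal (principal_ideal m)" "R (ideal_degree (principal_ideal m))"
    by (simp_all add: nonzero_ideal_principal monic_nonzero ideal_degree_principal)
next
  fix P :: "'a poly set" assume "nonzero_ideal P" "R (ideal_degree P)"
  then show "P \<in> principal_ideal ` {m. monic m \<and> R (degree m)}"
    by (elim nonzero_ideal_generator) (auto simp: ideal_degree_principal)
qed

lemma coprime_ideal_iff:
  "{x + y | x y. x \<in> principal_ideal a \<and> y \<in> principal_ideal n} = UNIV
     \<longleftrightarrow> (\<exists>s t. s * a + t * n = (1 :: 'a::field poly))" (is "?L = UNIV \<longleftrightarrow> ?R")
proof
  assume "?L = UNIV"
  then have "1 \<in> ?L" by blast
  then show ?R by (fastforce simp: mem_principal_ideal dvd_def mult.commute)
next
  assume ?R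
  then obtain s t where st: "s * a + t * n = 1" by blast
  have "z \<in> ?L" for z
  proof -
    have "z = z * s * a + z * t * n" using st by (metis mult.assoc mult.right_neutral distrib_left)
    moreover have "z * s * a \<in> principal_ideal a" "z * t * n \<in> principal_ideal n"
      by (simp_all add: mem_principal_ideal)
    ultimately show ?thesis by blast
  qed
  then show "?L = UNIV" by blast
qed

subsection \<open>Polynomials of bounded degree\<close>

text \<open>The condition on coefficients gives an F_q-vector space of dimension n and encodes deg 0
  = -infinity, as in the range of b in S_p.\<close>

definition polys_below :: "nat \<Rightarrow> 'a::zero poly set" where
  "polys_below n = {f. \<forall>i\<ge>n. coeff f i = 0}"

lemma polys_below_iff: "f \<in> polys_below n \<longleftrightarrow> f = 0 \<or> degree f < n"
proof (cases "f = 0")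
  case False
  then have "coeff f (degree f) \<noteq> 0" by simp
  then show ?thesis using False by (force simp: polys_below_def coeff_eq_0 not_le[symmetric])
qed (simp add: polys_below_def)

lemma polys_below_0 [simp]: "polys_below 0 = {0}"
  by (auto simp: polys_below_iff)

lemma bij_betw_polys_below_Suc:
  "bij_betw (\<lambda>(t, f). f + monom t n) (UNIV \<times> polys_below n) (polys_below (Suc n) :: 'a::field poly set)"
proof (rule bij_betw_byWitness[where f' = "\<lambda>f. (coeff f n, f - monom (coeff f n) n)"])
  show "\<forall>x\<in>UNIV \<times> polys_below n. (\<lambda>f. (coeff f n, f - monom (coeff f n) n)) (case x of (t, f) \<Rightarrow> f + monom t n) = (x :: 'a \<times> 'a poly)"
    by (auto simp: polys_below_def)
  show "\<forall>f\<in>polys_below (Suc n). (case (coeff f n, f - monom (coeff f n) n) of (t, f) \<Rightarrow> f + monom t n) = (f :: 'a poly)"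
    by auto
  show "(\<lambda>(t, f). f + monom t n) ` (UNIV \<times> polys_below n) \<subseteq> (polys_below (Suc n) :: 'a poly set)"
    by (auto simp: polys_below_def)
  show "(\<lambda>f. (coeff f n, f - monom (coeff f n) n)) ` polys_below (Suc n) \<subseteq> UNIV \<times> (polys_below n :: 'a poly set)"
    by (auto simp: polys_below_def)
qed

lemma finite_polys_below [simp]: "finite (polys_below n :: 'a::{field, finite} poly set)"
proof (induction n)
  case (Suc n)
  then show ?case using bij_betw_finite[OF bij_betw_polys_below_Suc[of n, where 'a = 'a]] by simp
qed simp

lemma card_polys_below: "card (polys_below n :: 'a::{field, finite} poly set) = CARD('a) ^ n"
  by (induction n) (simp_all add: bij_betw_same_card[OF bij_betw_polys_below_Suc, symmetric] card_cartesian_product)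

text \<open>Splits off the top coefficient t; later each such inner sum over t becomes one
  application of harmonicity.\<close>

lemma sum_polys_below_Suc:
  "(\<Sum>f\<in>polys_below (Suc n). h f) = (\<Sum>t\<in>UNIV. \<Sum>f\<in>polys_below n. h (f + monom t n))"
  for h :: "'a::{field, finite} poly \<Rightarrow> 'b::comm_monoid_add"
  by (simp add: sum.reindex_bij_betw[OF bij_betw_polys_below_Suc, symmetric] sum.cartesian_product split_def)

lemma finite_monic_degree: "finite {m :: 'a::{field, finite} poly. monic m \<and> degree m \<le> d}"
  by (rule finite_subset[OF _ finite_polys_below[of "Suc d"]]) (auto simp: polys_below_iff)

section \<open>Matrices and edges\<close>

lemma mat2_mult:
  "mat2 a b c d ** mat2 a' b' c' d' =
     mat2 (a * a' + b * c') (a * b' + b * d') (c * a' + d * c') (c * b' + d * d' :: 'b::semiring_1)"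
  by (simp add: mat2_eq_iff matmul2_nth)

lemma mat2_inject [simp]: "mat2 a b c d = mat2 a' b' c' d' \<longleftrightarrow> a = a' \<and> b = b' \<and> c = c' \<and> d = d'"
  by (simp add: mat2_eq_iff)

lemma mat_eq_mat2: "mat z = mat2 z 0 0 (z :: 'b::semiring_1)"
  by (simp add: mat2_eq_iff)

lemma invertible_mat2: "invertible (mat2 a b c d) \<longleftrightarrow> a * d - b * c \<noteq> (0 :: 'b::field)"
  by (simp add: invertible_det_nz det_2)

lemma invertible_left_cancel:
  "invertible g \<Longrightarrow> g ** x = g ** y \<Longrightarrow> x = y"
  unfolding invertible_def by (metis matrix_mul_assoc matrix_mul_lid)

lemma mat2_GL2I:
  fixes a b c d :: "'a::field fls"
  assumes "a \<in> S" "b \<in> S" "c \<in> S" "d \<in> S" and D: "D = a * d - b * c" "D \<noteq> 0"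
    and "a / D \<in> S" "- b / D \<in> S" "- c / D \<in> S" "d / D \<in> S"
  shows "mat2 a b c d \<in> GL2 S"
proof -
  have *: "a * (d / D) + b * (- c / D) = 1" "d / D * a + - b / D * c = 1"
       "c * (- b / D) + d * (a / D) = 1" "- c / D * b + a / D * d = 1"
       "a * (- b / D) + b * (a / D) = 0" "c * (d / D) + d * (- c / D) = 0"
       "d / D * b + - b / D * d = 0" "- c / D * a + a / D * c = 0"
    using D by (simp_all add: divide_simps)
  then have "mat2 a b c d ** mat2 (d / D) (- b / D) (- c / D) (a / D) = mat 1"
    "mat2 (d / D) (- b / D) (- c / D) (a / D) ** mat2 a b c d = mat 1"
    unfolding mat2_mult mat_eq_mat2 mat2_inject by blast+
  moreover have "\<forall>i j. mat2 a b c d $ i $ j \<in> S"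
    "\<forall>i j. mat2 (d / D) (- b / D) (- c / D) (a / D) $ i $ j \<in> S"
    using assms by (simp_all only: forall_2 mat2_nth)
  ultimately show ?thesis unfolding GL2_def by blast
qed

lemma GL2_invertible: "g \<in> GL2 S \<Longrightarrow> invertible g"
  unfolding GL2_def invertible_def by blast

lemma upper_iwahori:
  assumes "u \<noteq> 0" "v \<noteq> 0" "fls_subdegree u = 0" "fls_subdegree v = 0" "b \<in> pi_ideal 0"
  shows "mat2 u b 0 v \<in> (iwahori :: 'a::field Kmat set)"
proof -
  have O: "u \<in> pi_ideal 0" "v \<in> pi_ideal 0" using assms by (auto simp: pi_ideal_iff)
  have sub: "fls_subdegree (u * v) = 0" "u * v \<noteq> 0" using assms by simp_all
  have "x / (u * v) \<in> pi_ideal 0" if "x \<in> pi_ideal 0" for x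
    using pi_ideal_divide[OF that sub(2)] sub(1) by simp
  then have "mat2 u b 0 v \<in> GL2 O_inf"
    using assms O sub(2) pi_ideal_closed(1,4)
    by (intro mat2_GL2I[where D = "u * v"]) (simp_all only: O_inf_eq, auto)
  then show ?thesis by (simp add: iwahori_def X_O_inf_eq)
qed

section \<open>Edges and vertices as cosets, and the action on them\<close>

lemma coset_rel_refl:
  assumes "mat 1 \<in> U" "invertible g"
  shows "coset_rel U g g"
  unfolding coset_rel_def using assms by (metis matrix_mul_rid one_neq_zero)

lemma coset_rel_mult_left:
  assumes "coset_rel U x y" "invertible g"
  shows "coset_rel U (g ** x) (g ** y)"
  using assms unfolding coset_rel_def by (metis invertible_mult matrix_mul_assoc)

lemma abs_edge_eq_iff:
  assumes "invertible g" "invertible h"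
  shows "abs_edge g = abs_edge h \<longleftrightarrow> coset_rel iwahori g h"
  using Quotient3_rel[OF Quotient3_edge, of g h] assms coset_rel_refl[OF iwahori_one] by blast

lemma abs_vertex_eq_iff:
  assumes "invertible g" "invertible h"
  shows "abs_vertex g = abs_vertex h \<longleftrightarrow> coset_rel (GL2 O_inf) g h"
  using Quotient3_rel[OF Quotient3_vertex, of g h] assms coset_rel_refl[OF GL2_O_one] by blast

lemma edge_exhaust:
  obtains g where "invertible g" "e = abs_edge g"
proof -
  have "coset_rel iwahori (rep_edge e) (rep_edge e)" "abs_edge (rep_edge e) = e"
    using Quotient3_edge unfolding Quotient3_def by blast+
  then show thesis using that by (metis coset_rel_def)
qed

lemma vertex_exhaust:
  obtains g where "invertible g" "v = abs_vertex g"
proof -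
  have "coset_rel (GL2 O_inf) (rep_vertex v) (rep_vertex v)" "abs_vertex (rep_vertex v) = v"
    using Quotient3_vertex unfolding Quotient3_def by blast+
  then show thesis using that by (metis coset_rel_def)
qed

lemma origin_abs_edge: "invertible g \<Longrightarrow> origin (abs_edge g) = abs_vertex g"
  by (simp add: coset_rel_refl iwahori_one origin.abs_eq)

lemma opposite_abs_edge:
  "invertible g \<Longrightarrow> opposite (abs_edge g) = abs_edge (g ** mat2 0 1 fls_X 0)"
  by (simp add: coset_rel_refl iwahori_one opposite.abs_eq)

lemma abs_edge_mult_iwahori:
  fixes g :: "'a::field Kmat"
  assumes "invertible g" "z \<noteq> 0" "k \<in> iwahori"
  shows "abs_edge (g ** (mat z ** k)) = abs_edge g"
proof -
  have "invertible (mat z :: 'a Kmat)" using assms(2) by (simp add: mat_eq_mat2 invertible_mat2)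
  moreover have "invertible k" using assms(3) by (auto simp: iwahori_def intro: GL2_invertible)
  ultimately have "invertible (g ** (mat z ** k))" using assms by (simp add: invertible_mult)
  then show ?thesis
    using assms by (subst eq_commute, subst abs_edge_eq_iff) (auto simp: coset_rel_def)
qed

lemma act_mult:
  assumes "invertible g" "invertible h"
  shows "act (g ** h) e = act g (act h e)"
proof -
  obtain x where "invertible x" "e = abs_edge x" by (rule edge_exhaust)
  then show ?thesis using assms by (simp add: act_abs_edge invertible_mult matrix_mul_assoc)
qed

lemma act_scalar:
  fixes z :: "'a::field fls"
  assumes "z \<noteq> 0"
  shows "act (mat z) e = e"
proof -
  obtain x where x: "invertible x" "e = abs_edge x" by (rule edge_exhaust)
  have "invertible (mat z :: 'a Kmat)" using assms by (simp add: mat_eq_mat2 invertible_mat2)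
  then have "act (mat z) e = abs_edge (mat z ** x)" using x by (simp add: act_abs_edge)
  also have "\<dots> = abs_edge (x ** (mat z ** mat 1))" by (simp add: mat_commute2)
  also have "\<dots> = e" using abs_edge_mult_iwahori[OF x(1) assms iwahori_one] x(2) by simp
  finally show ?thesis .
qed

lemma act_one: "act (mat 1) e = e"
  by (simp add: act_scalar)

lemma act_opposite:
  assumes "invertible g"
  shows "act g (opposite e) = opposite (act g e)"
proof -
  obtain x where x: "invertible x" "e = abs_edge x" by (rule edge_exhaust)
  have "invertible (mat2 0 1 fls_X (0 :: 'a fls))" by (simp add: invertible_mat2)
  then show ?thesis
    using x assms by (simp add: opposite_abs_edge act_abs_edge invertible_mult matrix_mul_assoc)
qed

text \<open>Translates the star of a vertex. The image vertex is written with the matrix product, so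
  that no separate action on vertices has to be defined.\<close>

lemma bij_betw_act_origin:
  assumes g: "invertible g" and h: "invertible h"
  shows "bij_betw (act g) {e. origin e = abs_vertex h} {e. origin e = abs_vertex (g ** h)}"
proof -
  obtain g' where g': "g ** g' = mat 1" "g' ** g = mat 1" using g by (auto simp: invertible_def)
  then have inv': "invertible g'" by (auto simp: invertible_def)
  have *: "origin (act g e) = abs_vertex (g ** h)"
    if "origin e = abs_vertex h" "invertible g" "invertible h" for e g and h :: "'a Kmat"
  proof -
    obtain x where x: "invertible x" "e = abs_edge x" by (rule edge_exhaust)
    then have "coset_rel (GL2 O_inf) x h" using that by (simp add: origin_abs_edge abs_vertex_eq_iff)
    then have "coset_rel (GL2 O_inf) (g ** x) (g ** h)" using that by (simp add: coset_rel_mult_left)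
    then show ?thesis
      using that x by (simp add: act_abs_edge origin_abs_edge invertible_mult abs_vertex_eq_iff)
  qed
  show ?thesis
  proof (rule bij_betw_byWitness[where f' = "act g'"])
    show "act g ` {e. origin e = abs_vertex h} \<subseteq> {e. origin e = abs_vertex (g ** h)}"
      using * g h by auto
    have "origin (act g' e) = abs_vertex (g' ** (g ** h))" if "origin e = abs_vertex (g ** h)" for e
      using *[OF that inv'] g h by (simp add: invertible_mult)
    then show "act g' ` {e. origin e = abs_vertex (g ** h)} \<subseteq> {e. origin e = abs_vertex h}"
      by (auto simp: matrix_mul_assoc g')
  qed (simp_all add: act_mult[symmetric] g inv' g' act_one)
qed

subsection \<open>Edges of upper triangular matrices\<close>

text \<open>The edge whose value the overview writes as F(pi^k, y). By \<open>abs_edge_upper\<close>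
  every invertible upper triangular matrix represents such an edge, and by
  \<open>edge_at_cong\<close> only y modulo pi^k matters.\<close>

definition edge_at :: "int \<Rightarrow> 'a::field fls \<Rightarrow> 'a edge" where
  "edge_at k y = abs_edge (mat2 (fls_X_intpow k) y 0 1)"

text \<open>The two matrices differ on the right by the scalar d'/d and an upper triangular matrix
  with diagonal (u, 1) and corner w. Equal degrees make u a unit, and the congruence on b/d says
  exactly that w is integral.\<close>

lemma abs_edge_upper_eqI:
  fixes a b d a' b' d' :: "'a::field fls"
  assumes nz: "a \<noteq> 0" "d \<noteq> 0" "a' \<noteq> 0" "d' \<noteq> 0"
    and deg: "fls_subdegree a' - fls_subdegree d' = fls_subdegree a - fls_subdegree d"
    and diff: "b' / d' - b / d \<in> pi_ideal (fls_subdegree a - fls_subdegree d)"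
  shows "abs_edge (mat2 a b 0 d) = abs_edge (mat2 a' b' 0 d')"
proof -
  define z u w where "z = d' / d" and "u = (a' * d) / (a * d')" and "w = d * (b' / d' - b / d) / a"
  have "fls_subdegree u = 0" "u \<noteq> 0"
    using nz deg by (simp_all add: u_def fls_divide_subdegree)
  moreover have "w \<in> pi_ideal 0"
  proof -
    have "d \<in> pi_ideal (fls_subdegree d)" by (simp add: pi_ideal_iff)
    from pi_ideal_divide[OF pi_ideal_mult[OF this diff] nz(1)]
    show ?thesis by (simp add: w_def)
  qed
  ultimately have "mat2 u w 0 1 \<in> iwahori" by (intro upper_iwahori) auto
  moreover have "mat2 a' b' 0 d' = mat2 a b 0 d ** (mat z ** mat2 u w 0 1)"
    using nz by (simp add: mat_eq_mat2 mat2_mult z_def u_def w_def field_simps)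
  moreover have "invertible (mat2 a b 0 d)" "z \<noteq> 0" using nz by (simp_all add: invertible_mat2 z_def)
  ultimately show ?thesis by (simp add: abs_edge_mult_iwahori)
qed

lemma abs_edge_upper:
  assumes "a \<noteq> 0" "d \<noteq> 0"
  shows "abs_edge (mat2 a b 0 d) = edge_at (fls_subdegree a - fls_subdegree d) (b / d)"
  unfolding edge_at_def using assms by (intro abs_edge_upper_eqI) (auto simp: fls_shift_eq0_iff)

lemma edge_at_cong: "y' - y \<in> pi_ideal k \<Longrightarrow> edge_at k y = edge_at k y'"
  unfolding edge_at_def by (intro abs_edge_upper_eqI) auto

lemma invertible_edge_at: "invertible (mat2 (fls_X_intpow k) y 0 (1 :: 'a::field fls))"
  by (simp add: invertible_mat2)

subsection \<open>The edges with a given origin\<close>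

text \<open>Cosets of the Iwahori group in GL_2(O_inf) correspond to points of P^1(F_q), through the
  first column (a : c) modulo pi. The point at infinity is the Iwahori group itself; any other point
  is t = a/c modulo pi.\<close>

lemma GL2_O_decompose:
  assumes k: "k \<in> GL2 (O_inf :: 'a::field fls set)"
  obtains "k \<in> iwahori"
    | t m where "m \<in> iwahori" "k = mat2 (fls_const t) 1 1 0 ** m"
proof (cases "k $ 2 $ 1 \<in> pi_ideal 1")
  case True
  then show thesis using that(1) k by (simp add: iwahori_def X_O_inf_eq)
next
  case False
  define a b c d where "a = k$1$1" and "b = k$1$2" and "c = k$2$1" and "d = k$2$2"
  have O: "a \<in> pi_ideal 0" "b \<in> pi_ideal 0" "c \<in> pi_ideal 0" "d \<in> pi_ideal 0"
    using k by (simp_all add: GL2_def O_inf_eq a_def b_def c_def d_def)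
  have keq: "k = mat2 a b c d" by (simp add: a_def b_def c_def d_def mat2_eq_iff)
  have c: "c \<noteq> 0" "fls_subdegree c = 0"
    using False O(3) unfolding c_def[symmetric] by (auto simp: pi_ideal_iff)
  define t where "t = fls_nth (a / c) 0"
  have "a / c \<in> pi_ideal 0" using pi_ideal_divide[OF O(1) c(1)] c(2) by simp
  then have "a / c - fls_const t \<in> pi_ideal 1"
    using pi_ideal_SucI[of "a / c - fls_const t" 0] by (simp add: t_def const_in_pi_ideal)
  from pi_ideal_mult[OF this O(3)] c have ac: "a - fls_const t * c \<in> pi_ideal 1"
    by (simp add: algebra_simps)
  \<comment> \<open>This is the inverse of the flip matrix for t; it turns the lower left entry c
    into a - t c, which is divisible by pi.\<close>
  define s where "s = (mat2 0 1 1 (- fls_const t) :: 'a Kmat)"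
  have "s \<in> GL2 O_inf"
    unfolding s_def by (rule mat2_GL2I[where D = "-1"]) (simp_all add: O_inf_eq pi_ideal_def)
  then have "s ** k \<in> GL2 O_inf" using k by (rule GL2_O_mult)
  moreover have "(s ** k) $ 2 $ 1 \<in> pi_ideal 1"
    using ac by (simp add: s_def keq mat2_mult)
  ultimately have "s ** k \<in> iwahori" by (simp add: iwahori_def X_O_inf_eq)
  moreover have "k = mat2 (fls_const t) 1 1 0 ** (s ** k)"
    by (simp add: s_def keq mat2_mult)
  ultimately show thesis by (rule that(2))
qed

text \<open>Modulo pi an Iwahori matrix is upper triangular and invertible, so its diagonal entries
  are units. This is what separates the q + 1 edges with a common origin.\<close>

lemma iwahori_entries:
  assumes "k \<in> (iwahori :: 'a::field Kmat set)"
  shows "fls_nth (k$2$1) 0 = 0" "fls_nth (k$1$1) 0 \<noteq> 0" "fls_nth (k$2$2) 0 \<noteq> 0"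
proof -
  have O: "k$i$j \<in> pi_ideal 0" for i j using assms by (simp add: iwahori_def GL2_def O_inf_eq)
  have 21: "k$2$1 \<in> pi_ideal 1" using assms by (simp add: iwahori_def X_O_inf_eq)
  then show "fls_nth (k$2$1) 0 = 0" by (simp add: pi_ideal_def)
  obtain h where h: "h \<in> iwahori" "k ** h = mat 1" "h ** k = mat 1" by (rule iwahori_inverse[OF assms])
  have hO: "h$i$j \<in> pi_ideal 0" for i j using h by (simp add: iwahori_def GL2_def O_inf_eq)
  have eq: "h$1$1 * k$1$1 + h$1$2 * k$2$1 = 1" "k$2$1 * h$1$2 + k$2$2 * h$2$2 = 1"
    using h by (simp_all add: mat2_eq_iff matmul2_nth)
  show "fls_nth (k$1$1) 0 \<noteq> 0"
  proof
    assume "fls_nth (k$1$1) 0 = 0"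
    then have "k$1$1 \<in> pi_ideal 1" using pi_ideal_SucI[of _ 0] O[of 1 1] by simp
    then have "(1 :: 'a fls) \<in> pi_ideal (0 + 1)"
      by (subst eq(1)[symmetric]) (intro pi_ideal_closed pi_ideal_mult hO 21)
    then show False by (simp add: pi_ideal_iff)
  qed
  show "fls_nth (k$2$2) 0 \<noteq> 0"
  proof
    assume "fls_nth (k$2$2) 0 = 0"
    then have "k$2$2 \<in> pi_ideal 1" using pi_ideal_SucI[of _ 0] O[of 2 2] by simp
    then have "(1 :: 'a fls) \<in> pi_ideal (1 + 0)"
      by (subst eq(2)[symmetric]) (intro pi_ideal_closed pi_ideal_mult hO 21)
    then show False by (simp add: pi_ideal_iff)
  qed
qed

lemma invertible_flip: "invertible (mat2 (fls_const (t :: 'a::field)) 1 1 0)"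
  by (simp add: invertible_mat2)

lemma abs_edge_flip_neq:
  assumes g: "invertible g"
  shows "abs_edge g \<noteq> abs_edge (g ** mat2 (fls_const (t :: 'a::field)) 1 1 0)"
proof
  assume "abs_edge g = abs_edge (g ** mat2 (fls_const t) 1 1 0)"
  then obtain z k where zk: "z \<noteq> 0" "k \<in> iwahori" "g ** mat2 (fls_const t) 1 1 0 = g ** (mat z ** k)"
    using g invertible_flip[of t] by (subst (asm) abs_edge_eq_iff) (auto simp: invertible_mult coset_rel_def)
  then have "mat2 (fls_const t) 1 1 0 = mat z ** k" using g invertible_left_cancel by blast
  then have "z * k$2$2 = 0" by (simp add: mat2_eq_iff matmul2_nth)
  then show False using zk iwahori_entries(3)[OF zk(2)] by auto
qed

lemma inj_abs_edge_flip:
  assumes g: "invertible g"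
  shows "inj (\<lambda>t. abs_edge (g ** mat2 (fls_const (t :: 'a::field)) 1 1 0))"
proof
  fix s t assume "abs_edge (g ** mat2 (fls_const s) 1 1 0) = abs_edge (g ** mat2 (fls_const t) 1 1 0)"
  then obtain z k where zk: "z \<noteq> 0" "k \<in> iwahori"
    "g ** mat2 (fls_const t) 1 1 0 = (g ** mat2 (fls_const s) 1 1 0) ** (mat z ** k)"
    using g invertible_flip[of s] invertible_flip[of t]
    by (subst (asm) abs_edge_eq_iff) (auto simp: invertible_mult coset_rel_def)
  then have "mat2 (fls_const t) 1 1 0 = mat2 (fls_const s) 1 1 0 ** (mat z ** k)"
    using g invertible_left_cancel by (metis matrix_mul_assoc)
  then have eq: "fls_const t = fls_const s * (z * k$1$1) + z * k$2$1" "1 = z * k$1$1"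
    by (simp_all add: mat2_eq_iff matmul2_nth)
  \<comment> \<open>Subtracting s times the second equation from the first gives t - s = z k21.
    After multiplication by k11 the unknown scalar z disappears, and the constant coefficients can
    be compared.\<close>
  then have "fls_const (t - s) * k$1$1 = z * k$1$1 * k$2$1"
    by (simp add: fls_minus_const[symmetric] algebra_simps)
  then have "fls_nth (fls_const (t - s) * k$1$1) 0 = fls_nth (k$2$1) 0" using eq(2) by simp
  then show "s = t" using iwahori_entries[OF zk(2)] by simp
qed

lemma origin_edges:
  assumes g: "invertible g"
  shows "{e. origin e = abs_vertex g} =
    insert (abs_edge g) (range (\<lambda>t. abs_edge (g ** mat2 (fls_const (t :: 'a::field)) 1 1 0)))"
    (is "_ = ?R")
proof safe
  fix e :: "'a edge" assume e: "origin e = abs_vertex g" and ne: "e \<notin> range (\<lambda>t. abs_edge (g ** mat2 (fls_const t) 1 1 0))"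
  obtain x where x: "invertible x" "e = abs_edge x" by (rule edge_exhaust)
  then have "coset_rel (GL2 O_inf) g x" using e g by (simp add: origin_abs_edge flip: abs_vertex_eq_iff)
  then obtain z k where zk: "z \<noteq> 0" "k \<in> GL2 O_inf" "x = g ** (mat z ** k)"
    by (auto simp: coset_rel_def)
  from zk(2) show "e = abs_edge g"
  proof (cases rule: GL2_O_decompose)
    case 1
    then show ?thesis using zk x g by (simp add: abs_edge_mult_iwahori)
  next
    case (2 t m)
    have "x = (g ** mat2 (fls_const t) 1 1 0) ** (mat z ** m)"
      unfolding zk(3) 2(2) by (metis mat_commute2 matrix_mul_assoc)
    then have "e = abs_edge (g ** mat2 (fls_const t) 1 1 0)"
      using abs_edge_mult_iwahori[OF invertible_mult[OF g invertible_flip] zk(1) 2(1)] x by simp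
    then show ?thesis using ne by blast
  qed
next
  show "origin (abs_edge g) = abs_vertex g" using g by (rule origin_abs_edge)
next
  fix t :: 'a
  have "(mat2 (fls_const t) 1 1 0 :: 'a Kmat) \<in> GL2 O_inf"
    by (rule mat2_GL2I[where D = "-1"]) (simp_all add: O_inf_eq pi_ideal_def)
  then have "coset_rel (GL2 O_inf) g (g ** mat2 (fls_const t) 1 1 0)"
    unfolding coset_rel_def using g invertible_flip
    by (metis invertible_mult matrix_mul_lid one_neq_zero)
  then show "origin (abs_edge (g ** mat2 (fls_const t) 1 1 0)) = abs_vertex g"
    by (metis abs_vertex_eq_iff g invertible_flip invertible_mult origin_abs_edge)
qed

subsection \<open>Harmonicity in terms of matrices\<close>

lemma harmonic_opposite:
  "harmonic F \<Longrightarrow> invertible g \<Longrightarrow> F (abs_edge (g ** mat2 0 1 fls_X 0)) = - F (abs_edge g)"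
  unfolding harmonic_def using opposite_abs_edge by (metis add_eq_0_iff)

text \<open>Up to the scalar pi, each flipped edge is the opposite of the edge of g (pi t; 0 1). So
  the two harmonicity conditions merge into one relation, and its matrices stay upper triangular if
  g is.\<close>

lemma harmonic_sum:
  fixes F :: "'a::{field, finite} edge \<Rightarrow> 'r::comm_ring_1"
  assumes F: "harmonic F" and g: "invertible g"
  shows "F (abs_edge g) = (\<Sum>t\<in>UNIV. F (abs_edge (g ** mat2 fls_X (fls_const t) 0 1)))"
proof -
  have *: "F (abs_edge (g ** mat2 (fls_const t) 1 1 0)) = - F (abs_edge (g ** mat2 fls_X (fls_const t) 0 1))" for t
  proof -
    let ?h = "g ** mat2 fls_X (fls_const t) 0 1"
    have "invertible (mat2 fls_X (fls_const t) 0 1)" by (simp add: invertible_mat2)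
    then have h: "invertible ?h" using g by (simp add: invertible_mult)
    have "?h ** mat2 0 1 fls_X 0 = (g ** mat2 (fls_const t) 1 1 0) ** (mat fls_X ** mat 1)"
      by (simp add: matrix_mul_assoc[symmetric] mat_eq_mat2 mat2_mult mult.commute)
    then have "abs_edge (?h ** mat2 0 1 fls_X 0) = abs_edge (g ** mat2 (fls_const t) 1 1 0)"
      using abs_edge_mult_iwahori[OF invertible_mult[OF g invertible_flip] fls_X_nonzero iwahori_one] by simp
    then show ?thesis using harmonic_opposite[OF F h] by simp
  qed
  have "0 = (\<Sum>e | origin e = abs_vertex g. F e)" using F by (simp add: harmonic_def)
  also have "\<dots> = F (abs_edge g) + (\<Sum>t\<in>UNIV. F (abs_edge (g ** mat2 (fls_const t) 1 1 0)))"
    unfolding origin_edges[OF g] using abs_edge_flip_neq[OF g]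
    by (subst sum.insert) (auto simp: sum.reindex[OF inj_abs_edge_flip[OF g]])
  finally show ?thesis by (simp add: * sum_negf)
qed

lemma harmonic_edge_at:
  fixes F :: "'a::{field, finite} edge \<Rightarrow> 'r::comm_ring_1"
  assumes "harmonic F"
  shows "F (edge_at k y) = (\<Sum>t\<in>UNIV. F (edge_at (k + 1) (y + fls_const t * fls_X_intpow k)))"
proof -
  have "fls_X_intpow k * fls_X = (fls_X_intpow (k + 1) :: 'a fls)"
    by (simp add: fls_X_times_conv_shift)
  then have "mat2 (fls_X_intpow k) y 0 1 ** mat2 fls_X (fls_const t) 0 1 =
     mat2 (fls_X_intpow (k + 1)) (y + fls_const t * fls_X_intpow k) 0 1" for t
    unfolding mat2_mult mat2_inject by (simp add: add.commute mult.commute)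
  then show ?thesis
    unfolding edge_at_def by (subst harmonic_sum[OF assms invertible_edge_at]) simp
qed

section \<open>The group $\Gamma_0(\mathfrak{n})$ and the sets $S_\mathfrak{p}$\<close>

definition A_mat :: "'a::field poly \<Rightarrow> 'a poly \<Rightarrow> 'a poly \<Rightarrow> 'a poly \<Rightarrow> 'a Kmat" where
  "A_mat a b c d = mat2 (of_A a) (of_A b) (of_A c) (of_A d)"

lemma A_mat_mult:
  "A_mat a b c d ** A_mat a' b' c' d' =
     A_mat (a * a' + b * c') (a * b' + b * d') (c * a' + d * c') (c * b' + d * d')"
  by (simp add: A_mat_def mat2_mult of_A_add of_A_mult)

lemma A_mat_inject [simp]: "A_mat a b c d = A_mat a' b' c' d' \<longleftrightarrow> a = a' \<and> b = b' \<and> c = c' \<and> d = d'"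
  by (simp add: A_mat_def)

lemma invertible_A_mat: "invertible (A_mat a b c d) \<longleftrightarrow> a * d - b * c \<noteq> 0"
proof -
  have "of_A a * of_A d - of_A b * of_A c = of_A (a * d - b * c)" by (simp add: of_A_diff of_A_mult)
  then show ?thesis unfolding A_mat_def invertible_mat2 by (simp only: of_A_eq_0_iff)
qed

lemma A_mat_scalar: "A_mat a 0 0 a = mat (of_A a)"
  by (simp add: A_mat_def mat_eq_mat2)

text \<open>The witness \<open>v\<close> inverts the determinant. Membership in GL_2(A) thus becomes
  a polynomial identity, without describing the units of A.\<close>

lemma Gamma0I:
  assumes "c \<in> N" "v * (a * d - b * c) = 1"
  shows "A_mat a b c d \<in> Gamma0 N"
proof -
  define D where "D = a * d - b * c"
  have vD: "of_A v * of_A D = 1" using assms(2) by (simp add: D_def flip: of_A_mult)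
  then have D: "of_A D \<noteq> 0" by auto
  have div: "of_A x / of_A D = of_A (x * v)" for x
    using D vD by (simp add: nonzero_divide_eq_eq of_A_mult mult.assoc)
  have "of_A D = of_A a * of_A d - of_A b * of_A c"
    by (simp only: D_def of_A_diff of_A_mult)
  from this D have "A_mat a b c d \<in> GL2 (range of_A)"
    unfolding A_mat_def
    by (rule mat2_GL2I[rotated 4]) (simp_all only: of_A_minus[symmetric] div rangeI)
  then show ?thesis using assms(1) by (simp add: Gamma0_def A_mat_def)
qed

lemma Gamma0E:
  assumes "g \<in> Gamma0 N"
  obtains a b c d v where "g = A_mat a b c d" "c \<in> N" "v * (a * d - b * c) = 1"
proof -
  have g: "g $ i $ j \<in> range of_A" for i j using assms by (simp add: Gamma0_def GL2_def)
  obtain c where c: "c \<in> N" "g $ 2 $ 1 = of_A c" using assms by (auto simp: Gamma0_def)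
  obtain a b d where abd: "g $ 1 $ 1 = of_A a" "g $ 1 $ 2 = of_A b" "g $ 2 $ 2 = of_A d"
    using g[of 1 1] g[of 1 2] g[of 2 2] by blast
  have geq: "g = A_mat a b c d" by (simp add: A_mat_def mat2_eq_iff c abd)
  obtain h where h: "\<And>i j. h $ i $ j \<in> range of_A" "g ** h = mat 1"
    using assms by (auto simp: Gamma0_def GL2_def)
  obtain a' b' c' d' where "h $ 1 $ 1 = of_A a'" "h $ 1 $ 2 = of_A b'" "h $ 2 $ 1 = of_A c'" "h $ 2 $ 2 = of_A d'"
    using h(1)[of 1 1] h(1)[of 1 2] h(1)[of 2 1] h(1)[of 2 2] by blast
  then have heq: "h = A_mat a' b' c' d'" by (simp add: A_mat_def mat2_eq_iff)
  have "A_mat a b c d ** A_mat a' b' c' d' = A_mat 1 0 0 1"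
    using h(2) by (simp add: geq heq A_mat_scalar)
  then have "a * a' + b * c' = 1" "a * b' + b * d' = 0" "c * a' + d * c' = 0" "c * b' + d * d' = 1"
    unfolding A_mat_mult A_mat_inject by blast+
  then have "(a' * d' - b' * c') * (a * d - b * c) = 1" by algebra
  then show thesis using that geq c by blast
qed

lemma Gamma0_invertible: "g \<in> Gamma0 N \<Longrightarrow> invertible g"
  by (auto simp: Gamma0_def intro: GL2_invertible)

lemma Gamma0_one: "nonzero_ideal N \<Longrightarrow> mat 1 \<in> Gamma0 N"
  using Gamma0I[of 0 N 1 1 1 0] by (simp add: nonzero_ideal_iff A_mat_scalar)

lemma Gamma0_mult:
  assumes N: "nonzero_ideal N" and "g \<in> Gamma0 N" "h \<in> Gamma0 N"
  shows "g ** h \<in> Gamma0 N"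
proof -
  obtain a b c d v where g: "g = A_mat a b c d" "c \<in> N" "v * (a * d - b * c) = 1"
    using assms(2) by (rule Gamma0E)
  obtain a' b' c' d' v' where h: "h = A_mat a' b' c' d'" "c' \<in> N" "v' * (a' * d' - b' * c') = 1"
    using assms(3) by (rule Gamma0E)
  have "a' * c \<in> N" "d * c' \<in> N" using N g h unfolding nonzero_ideal_iff by blast+
  then have "c * a' + d * c' \<in> N" using N unfolding nonzero_ideal_iff by (metis mult.commute)
  moreover have "(v * v') * ((a * a' + b * c') * (c * b' + d * d') - (a * b' + b * d') * (c * a' + d * c')) =
    (v * (a * d - b * c)) * (v' * (a' * d' - b' * c'))"
    by (simp add: algebra_simps)
  ultimately show ?thesis
    unfolding g(1) h(1) A_mat_mult using g(3) h(3) by (intro Gamma0I[where v = "v * v'"]) simp_all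
qed

lemma Gamma0_inverse:
  assumes N: "nonzero_ideal N" and "g \<in> Gamma0 N"
  obtains h where "h \<in> Gamma0 N" "g ** h = mat 1" "h ** g = mat 1"
proof -
  obtain a b c d v where g: "g = A_mat a b c d" "c \<in> N" and v: "v * (a * d - b * c) = 1"
    using assms(2) by (rule Gamma0E)
  let ?h = "A_mat (v * d) (- (v * b)) (- v * c) (v * a)"
  have "?h \<in> Gamma0 N"
  proof (rule Gamma0I)
    show "- v * c \<in> N" using N g unfolding nonzero_ideal_iff by blast
    show "(a * d - b * c) * (v * d * (v * a) - - (v * b) * (- v * c)) = 1" using v by algebra
  qed
  moreover have "g ** ?h = A_mat 1 0 0 1"
    unfolding g(1) A_mat_mult A_mat_inject by (subst v[symmetric])+ (simp add: algebra_simps)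
  moreover have "?h ** g = A_mat 1 0 0 1"
    unfolding g(1) A_mat_mult A_mat_inject by (subst v[symmetric])+ (simp add: algebra_simps)
  ultimately show thesis using that by (simp add: A_mat_scalar)
qed

section \<open>S_p as a set of representatives modulo Gamma_0(n)\<close>

lemma S_mats_principal:
  assumes "monic m"
  shows "S_mats (principal_ideal n) (principal_ideal m) =
    {A_mat a b 0 d | a b d. monic a \<and> monic d \<and> a * d = m \<and> (\<exists>s. n dvd s * a - 1) \<and>
       b \<in> polys_below (degree d)}"
proof -
  have "principal_ideal (a * d) = principal_ideal m \<longleftrightarrow> a * d = m" if "monic a" "monic d" for a d :: "'a poly"
    using principal_ideal_inj[OF monic_mult[OF that] assms] by blast
  moreover have "(\<exists>s t. s * a + t * n = 1) \<longleftrightarrow> (\<exists>s. n dvd s * a - 1)" for a :: "'a poly"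
  proof
    assume "\<exists>s t. s * a + t * n = 1"
    then obtain s t where "s * a + t * n = 1" by blast
    then have "s * a - 1 = n * (- t)" by algebra
    then show "\<exists>s. n dvd s * a - 1" by (metis dvd_triv_left)
  next
    assume "\<exists>s. n dvd s * a - 1"
    then obtain s t where "s * a - 1 = n * t" by (auto elim: dvdE)
    then have "s * a + (- t) * n = 1" by algebra
    then show "\<exists>s t. s * a + t * n = 1" by blast
  qed
  ultimately show ?thesis
    unfolding S_mats_def coprime_ideal_iff polys_below_iff A_mat_def of_A_0 by (intro Collect_cong) (metis (no_types, opaque_lifting))
qed

lemma finite_S_mats:
  assumes "nonzero_ideal N" "nonzero_ideal (P :: 'a::{field, finite} poly set)"
  shows "finite (S_mats N P)"
proof -
  obtain n where n: "N = principal_ideal n" using assms(1) by (blast elim: nonzero_ideal_generator)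
  obtain m where m: "monic m" "P = principal_ideal m" using assms(2) by (rule nonzero_ideal_generator)
  let ?B = "polys_below (Suc (degree m)) :: 'a poly set"
  have "S_mats N P \<subseteq> (\<lambda>(a, b, d). A_mat a b 0 d) ` (?B \<times> ?B \<times> ?B)"
  proof
    fix g assume "g \<in> S_mats N P"
    then obtain a b d where *: "g = A_mat a b 0 d" "monic a" "monic d" "a * d = m" "b \<in> polys_below (degree d)"
      using m by (auto simp: n S_mats_principal)
    then have "degree m = degree a + degree d"
      using monic_nonzero[of a] monic_nonzero[of d] by (simp add: degree_mult_eq flip: *(4))
    then show "g \<in> (\<lambda>(a, b, d). A_mat a b 0 d) ` (?B \<times> ?B \<times> ?B)"
      using * by (intro image_eqI[of _ _ "(a, b, d)"]) (auto simp: polys_below_iff)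
  qed
  then show ?thesis by (rule finite_subset) simp
qed

lemma S_mats_invertible: "nonzero_ideal P \<Longrightarrow> g \<in> S_mats N P \<Longrightarrow> invertible g"
  unfolding S_mats_def by (auto simp: invertible_mat2 dest: monic_nonzero)

text \<open>Reduction to Hermite normal form by row operations from $\Gamma_0(\mathfrak{n})$.\<close>

lemma S_mats_reduce:
  assumes N: "nonzero_ideal N" and P: "nonzero_ideal P"
    and g: "g \<in> S_mats N P" and h: "h \<in> Gamma0 (N :: 'a::field poly set)"
  shows "\<exists>g'\<in>S_mats N P. \<exists>h'\<in>Gamma0 N. g ** h = h' ** g'"
proof -
  obtain n where n: "N = principal_ideal n" using N by (blast elim: nonzero_ideal_generator)
  obtain m where m: "monic m" "P = principal_ideal m" using P by (rule nonzero_ideal_generator)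
  obtain a b d s where g': "g = A_mat a b 0 d" "monic a" "monic d" "a * d = m" "n dvd s * a - 1"
    using g m(1) unfolding m(2) n by (auto simp: S_mats_principal)
  obtain a' b' c' d' v where h': "h = A_mat a' b' c' d'" "c' \<in> N" and v: "v * (a' * d' - b' * c') = 1"
    using h by (rule Gamma0E)
  define \<alpha> \<beta> C \<delta> where "\<alpha> = a * a' + b * c'" and "\<beta> = a * b' + b * d'" and "C = d * c'" and "\<delta> = d * d'"
  have gh: "g ** h = A_mat \<alpha> \<beta> C \<delta>"
    by (simp add: g' h' A_mat_mult \<alpha>_def \<beta>_def C_def \<delta>_def)
  have "v * (\<alpha> * \<delta> - \<beta> * C) = (v * (a' * d' - b' * c')) * (a * d)"
    unfolding \<alpha>_def \<beta>_def C_def \<delta>_def by (simp add: algebra_simps)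
  then have det: "v * (\<alpha> * \<delta> - \<beta> * C) = m" by (simp add: v g'(4))
  have c'n: "n dvd c'" using h'(2) by (simp add: n mem_principal_ideal)
  \<comment> \<open>Modulo n, \<alpha> is a a' plus a multiple of c', hence a a'. Here s inverts a,
    and v d' inverts a' because n divides c'.\<close>
  have cop: "n dvd v * s * d' * \<alpha> - 1"
  proof -
    have "v * s * d' * \<alpha> - v * (a' * d' - b' * c') = v * a' * d' * (s * a - 1) + (v * s * d' * b + v * b') * c'"
      unfolding \<alpha>_def by (simp add: algebra_simps)
    then show ?thesis using g'(5) c'n by (simp add: v dvd_add)
  qed
  \<comment> \<open>The ideal of the first column of g h. Its monic generator e becomes the upper
    left entry of the normal form, and its Bezout coefficients x, y give the row operation (x y; -C1
    \<alpha>1) of determinant 1 that maps this column to (e, 0).\<close>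
  define I where "I = {x * \<alpha> + y * C | x y. True}"
  have "m \<noteq> 0" using m(1) by (rule monic_nonzero)
  then have "\<alpha> \<noteq> 0 \<or> C \<noteq> 0" using det by auto
  moreover have "\<alpha> \<in> I" "C \<in> I"
    unfolding I_def by (force intro: exI[of _ 1] exI[of _ 0])+
  moreover have "x + y \<in> I" if hyp: "x \<in> I" "y \<in> I" for x y
  proof -
    obtain x1 x2 y1 y2 where "x = x1 * \<alpha> + x2 * C" "y = y1 * \<alpha> + y2 * C" using hyp unfolding I_def by blast
    then have "x + y = (x1 + y1) * \<alpha> + (x2 + y2) * C" by algebra
    then show ?thesis unfolding I_def by blast
  qed
  moreover have "z * x \<in> I" if hyp: "x \<in> I" for x z
  proof -
    obtain x1 x2 where "x = x1 * \<alpha> + x2 * C" using hyp unfolding I_def by blast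
    then have "z * x = (z * x1) * \<alpha> + (z * x2) * C" by algebra
    then show ?thesis unfolding I_def by blast
  qed
  moreover from this[of \<alpha> 0] have "0 \<in> I" using \<open>\<alpha> \<in> I\<close> by simp
  ultimately have "nonzero_ideal I" unfolding nonzero_ideal_iff by blast
  then obtain e where e: "monic e" "I = principal_ideal e" by (rule nonzero_ideal_generator)
  then have "e \<noteq> 0" by (auto dest: monic_nonzero)
  have "e dvd \<alpha>" "e dvd C" using \<open>\<alpha> \<in> I\<close> \<open>C \<in> I\<close> by (simp_all add: e mem_principal_ideal)
  then obtain \<alpha>1 C1 where 1: "\<alpha> = e * \<alpha>1" "C = e * C1" by (auto elim!: dvdE)
  have "e \<in> I" by (simp add: e mem_principal_ideal)
  then obtain x y where xy: "e = x * \<alpha> + y * C" unfolding I_def by blast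
  have "e * (x * \<alpha>1 + y * C1) = x * \<alpha> + y * C" by (simp add: 1 algebra_simps)
  also have "\<dots> = e * 1" using xy by (rule trans[OF sym]) simp
  finally have xy1: "x * \<alpha>1 + y * C1 = 1" using \<open>e \<noteq> 0\<close> by simp
  have cop_e: "n dvd v * s * d' * \<alpha>1 * e - 1" using cop by (simp add: 1 mult_ac)
  \<comment> \<open>The row operation must lie in Gamma_0(n), so n has to divide C1 and not only C =
    e C1. This holds since e divides \<alpha> and is therefore invertible modulo n.\<close>
  have "n dvd C" using c'n by (simp add: C_def)
  then have "n dvd v * s * d' * \<alpha>1 * C - C1 * (v * s * d' * \<alpha>1 * e - 1)"
    by (rule dvd_diff[OF dvd_mult dvd_mult[OF cop_e]])
  also have "\<dots> = C1" by (simp add: 1 algebra_simps)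
  finally have "n dvd C1" .
  define \<delta>1 where "\<delta>1 = \<alpha>1 * \<delta> - C1 * \<beta>"
  \<comment> \<open>Scaling the second row by the unit v turns the determinant into exactly m; since
    e and m are monic, d1 is then monic too.\<close>
  define d1 where "d1 = v * \<delta>1"
  have ed: "e * d1 = m"
    unfolding det[symmetric] d1_def \<delta>1_def by (simp add: 1 algebra_simps)
  then have "monic (e * d1)" using m(1) by simp
  then have d1: "monic d1" using e(1) by (simp add: monic_def lead_coeff_mult)
  define B where "B = x * \<beta> + y * \<delta>"
  define g1 where "g1 = A_mat e (B mod d1) 0 d1"
  have "B mod d1 \<in> polys_below (degree d1)"
    using degree_mod_less[of d1 B] d1 by (auto simp: polys_below_iff dest: monic_nonzero)
  then have "g1 \<in> S_mats N P"
    unfolding n m(2) S_mats_principal[OF m(1)] g1_def using e(1) d1 ed cop_e by blast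
  moreover have "A_mat x y (- C1) \<alpha>1 \<in> Gamma0 N"
    using xy1 \<open>n dvd C1\<close> by (intro Gamma0I[where v = 1]) (simp_all add: n mem_principal_ideal)
  moreover have "A_mat 1 (- v * (B div d1)) 0 v \<in> Gamma0 N"
    using v by (intro Gamma0I[where v = "a' * d' - b' * c'"]) (simp_all add: n mem_principal_ideal mult.commute)
  moreover have "(A_mat 1 (- v * (B div d1)) 0 v ** A_mat x y (- C1) \<alpha>1) ** (g ** h) = g1"
  proof -
    have "- C1 * \<alpha> + \<alpha>1 * C = 0" by (simp add: 1)
    then have *: "A_mat x y (- C1) \<alpha>1 ** (g ** h) = A_mat e B 0 \<delta>1"
      unfolding gh A_mat_mult A_mat_inject by (simp add: B_def \<delta>1_def xy[symmetric])
    have "B + - v * (B div d1) * \<delta>1 = B - B div d1 * d1"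
      by (simp add: d1_def)
    then have "B + - v * (B div d1) * \<delta>1 = B mod d1"
      by (simp only: minus_div_mult_eq_mod)
    then show ?thesis
      by (simp only: matrix_mul_assoc[symmetric] *) (simp add: A_mat_mult g1_def d1_def)
  qed
  ultimately have "\<exists>h1\<in>Gamma0 N. h1 ** (g ** h) = g1" using Gamma0_mult[OF N] by blast
  then obtain h1 where h1: "h1 \<in> Gamma0 N" "h1 ** (g ** h) = g1" by blast
  obtain h2 where "h2 \<in> Gamma0 N" "h2 ** h1 = mat 1" using Gamma0_inverse[OF N h1(1)] by blast
  moreover from this have "g ** h = h2 ** g1" using h1(2) by (metis matrix_mul_assoc matrix_mul_lid)
  ultimately show ?thesis using \<open>g1 \<in> S_mats N P\<close> by blast
qed

text \<open>A matrix h relating two triangular ones is itself triangular. Monic diagonals force its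
  unit diagonal entries to be 1, and then b and b' are reduced residues of the same class modulo d.
  This makes the reduction map of \<open>S_mats_reduce\<close> injective.\<close>

lemma S_mats_unique:
  assumes N: "nonzero_ideal N" and P: "nonzero_ideal P"
    and g: "g \<in> S_mats N P" "g' \<in> S_mats N P" and h: "h \<in> Gamma0 (N :: 'a::field poly set)" "g' = h ** g"
  shows "g' = g"
proof -
  obtain n where n: "N = principal_ideal n" using N by (blast elim: nonzero_ideal_generator)
  obtain m where m: "monic m" "P = principal_ideal m" using P by (rule nonzero_ideal_generator)
  obtain a b d where g1: "g = A_mat a b 0 d" "monic a" "monic d" "a * d = m" "b \<in> polys_below (degree d)"
    using g(1) m(1) unfolding m(2) n by (auto simp: S_mats_principal)
  obtain a' b' d' where g2: "g' = A_mat a' b' 0 d'" "monic a'" "monic d'" "a' * d' = m" "b' \<in> polys_below (degree d')"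
    using g(2) m(1) unfolding m(2) n by (auto simp: S_mats_principal)
  obtain p q r t v where h': "h = A_mat p q r t" "v * (p * t - q * r) = 1"
    using h(1) by (blast elim: Gamma0E)
  have eqs: "a' = p * a" "b' = p * b + q * d" "r * a = 0" "d' = r * b + t * d"
    using h(2) unfolding g1(1) g2(1) h'(1) A_mat_mult A_mat_inject by simp_all
  have "r = 0" using eqs(3) g1(2) by (auto dest: monic_nonzero)
  then have "v * (p * t) = 1" "d' = t * d" using h'(2) eqs(4) by simp_all
  then have "is_unit (p * t)" by (metis dvd_triv_right)
  then have "is_unit p" "is_unit t" using is_unit_mult_iff by blast+
  then obtain p0 t0 where pt: "p = [:p0:]" "t = [:t0:]" unfolding is_unit_poly_iff by blast
  have "p0 = 1" "t0 = 1"
    using g1(2,3) g2(2,3) unfolding eqs(1) \<open>d' = t * d\<close> pt by (auto simp: monic_def split: if_splits)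
  then have "a' = a" "d' = d" "b' - b = q * d" using eqs \<open>d' = t * d\<close> pt by (simp_all flip: one_pCons)
  moreover have "b' - b \<in> polys_below (degree d)"
    using g1(5) g2(5) \<open>d' = d\<close> by (simp add: polys_below_def)
  ultimately have "q = 0"
    using monic_nonzero[OF g1(3)] degree_mult_eq[of q d] \<open>b' - b = q * d\<close>
    by (cases "q = 0") (auto simp: polys_below_iff)
  then show ?thesis using \<open>a' = a\<close> \<open>d' = d\<close> \<open>b' - b = q * d\<close> by (simp add: g1(1) g2(1))
qed

section \<open>Hecke operators preserve $\mathcal{H}_0(\mathfrak{n}, R)$\<close>

lemma hecke_harmonic:
  fixes N P :: "'a::field poly set" and F :: "'a edge \<Rightarrow> 'r::comm_ring_1"
  assumes P: "nonzero_ideal P" and F: "harmonic F"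
  shows "harmonic (hecke N P F)"
  unfolding harmonic_def
proof (intro conjI allI)
  fix e
  have "F (act g e) + F (act g (opposite e)) = 0" if "g \<in> S_mats N P" for g
    using F S_mats_invertible[OF P that] by (simp add: act_opposite harmonic_def)
  then show "hecke N P F e + hecke N P F (opposite e) = 0"
    by (simp add: hecke_def flip: sum.distrib)
next
  fix v :: "'a vertex"
  obtain h where h: "invertible h" "v = abs_vertex h" by (rule vertex_exhaust)
  have "(\<Sum>e | origin e = v. F (act g e)) = 0" if "g \<in> S_mats N P" for g
    using F S_mats_invertible[OF P that] h
    by (simp add: sum.reindex_bij_betw[OF bij_betw_act_origin] harmonic_def)
  then have "(\<Sum>g\<in>S_mats N P. \<Sum>e | origin e = v. F (act g e)) = 0" by simp
  then show "(\<Sum>e | origin e = v. hecke N P F e) = 0"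
    unfolding hecke_def by (subst sum.swap)
qed

text \<open>Right multiplication by h permutes S_p up to left factors in Gamma_0(n), which F does
  not see: \<open>S_mats_reduce\<close> gives the map, \<open>S_mats_unique\<close> its injectivity,
  and finiteness its surjectivity.\<close>

lemma hecke_invariant:
  fixes N P :: "'a::{field, finite} poly set" and F :: "'a edge \<Rightarrow> 'r::comm_ring_1"
  assumes N: "nonzero_ideal N" and P: "nonzero_ideal P"
    and F: "\<And>h e. h \<in> Gamma0 N \<Longrightarrow> F (act h e) = F e" and h: "h \<in> Gamma0 N"
  shows "hecke N P F (act h e) = hecke N P F e"
proof -
  let ?S = "S_mats N P"
  obtain r where r: "\<And>g. g \<in> ?S \<Longrightarrow> r g \<in> ?S \<and> (\<exists>k\<in>Gamma0 N. g ** h = k ** r g)"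
    using S_mats_reduce[OF N P _ h] by metis
  have "inj_on r ?S"
  proof
    fix g g' assume g: "g \<in> ?S" "g' \<in> ?S" "r g = r g'"
    obtain k k' where k: "k \<in> Gamma0 N" "k' \<in> Gamma0 N" "g ** h = k ** r g" "g' ** h = k' ** r g'"
      using r g by metis
    obtain k1 where k1: "k1 \<in> Gamma0 N" "k1 ** k = mat 1" using Gamma0_inverse[OF N k(1)] by blast
    obtain h1 where h1: "h ** h1 = mat 1" using Gamma0_inverse[OF N h] by blast
    have "g' ** h = (k' ** k1) ** g ** h"
      using k k1 g(3) by (metis matrix_mul_assoc matrix_mul_lid)
    then have "g' = (k' ** k1) ** g" using h1 by (metis matrix_mul_assoc matrix_mul_rid)
    then show "g = g'" using S_mats_unique[OF N P g(1,2) Gamma0_mult[OF N k(2) k1(1)]] by simp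
  qed
  moreover have "r ` ?S \<subseteq> ?S" using r by blast
  ultimately have "bij_betw r ?S ?S"
    using endo_inj_surj[OF finite_S_mats[OF N P]] by (simp add: bij_betw_def)
  have "F (act g (act h e)) = F (act (r g) e)" if g: "g \<in> ?S" for g
  proof -
    obtain k where k: "k \<in> Gamma0 N" "g ** h = k ** r g" using r[OF g] by blast
    have "act g (act h e) = act k (act (r g) e)"
      using k r[OF g] g S_mats_invertible[OF P] Gamma0_invertible h by (metis act_mult)
    then show ?thesis using F k(1) by simp
  qed
  then have "hecke N P F (act h e) = (\<Sum>g\<in>?S. F (act (r g) e))"
    by (simp add: hecke_def)
  also have "\<dots> = hecke N P F e"
    unfolding hecke_def using \<open>bij_betw r ?S ?S\<close> by (rule sum.reindex_bij_betw)
  finally show ?thesis .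
qed

section \<open>Orbits, and why Hecke operators preserve cuspidality\<close>

lemma mem_orbit: "nonzero_ideal N \<Longrightarrow> e \<in> orbit N e"
  unfolding orbit_def using Gamma0_one act_one by (metis image_eqI)

lemma orbit_act:
  assumes N: "nonzero_ideal N" and h: "h \<in> Gamma0 N"
  shows "orbit N (act h e) = orbit N e"
proof -
  have sub: "orbit N (act h e) \<subseteq> orbit N e" if "h \<in> Gamma0 N" for h e
  proof
    fix x assume "x \<in> orbit N (act h e)"
    then obtain k where "k \<in> Gamma0 N" "x = act k (act h e)" by (auto simp: orbit_def)
    then have "k ** h \<in> Gamma0 N" "x = act (k ** h) e"
      using that N by (simp_all add: Gamma0_mult act_mult Gamma0_invertible)
    then show "x \<in> orbit N e" by (auto simp: orbit_def)
  qed
  obtain h' where "h' \<in> Gamma0 N" "h' ** h = mat 1" using Gamma0_inverse[OF N h] by blast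
  then have "e = act h' (act h e)"
    using h by (simp add: act_mult[symmetric] Gamma0_invertible act_one)
  then show ?thesis using sub h \<open>h' \<in> Gamma0 N\<close> by (metis subset_antisym)
qed

text \<open>If $M' = M + m n X$ and $\det M = u m$ with a unit $u$, then
  $M' M^{-1} = 1 + n u^{-1} X\,\mathrm{adj}(M)$ is integral and congruent to 1 modulo $n$.\<close>

lemma Gamma0_of_cong:
  assumes N: "N = principal_ideal n" and m: "m \<noteq> 0"
    and det: "p * t - q * s = u * m" "p' * t' - q' * s' = u' * m" and u: "v * u = 1" "v' * u' = 1"
    and cong: "m * n dvd p' - p" "m * n dvd q' - q" "m * n dvd s' - s" "m * n dvd t' - t"
  shows "\<exists>h\<in>Gamma0 N. A_mat p' q' s' t' = h ** A_mat p q s t"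
proof -
  obtain x1 x2 x3 x4 where x: "p' = p + m * n * x1" "q' = q + m * n * x2" "s' = s + m * n * x3" "t' = t + m * n * x4"
  proof -
    have "\<exists>x. a' = a + m * n * x" if dvd: "m * n dvd a' - a" for a a' :: "'a poly"
    proof -
      obtain k where "a' - a = m * n * k" using dvd by (rule dvdE)
      then have "a' = a + m * n * k" by (simp add: diff_eq_eq add.commute)
      then show ?thesis ..
    qed
    then show ?thesis using cong that by metis
  qed
  have vm: "v * (p * t - q * s) = m" unfolding det(1) using u(1) by (simp flip: mult.assoc)
  define a b c d where "a = 1 + n * v * (x1 * t - x2 * s)" and "b = n * v * (x2 * p - x1 * q)"
    and "c = n * v * (x3 * t - x4 * s)" and "d = 1 + n * v * (x4 * p - x3 * q)"
  have prod: "a * p + b * s = p'" "a * q + b * t = q'" "c * p + d * s = s'" "c * q + d * t = t'"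
    unfolding a_def b_def c_def d_def x vm[symmetric] by (simp_all add: algebra_simps)
  have "(a * d - b * c) * (p * t - q * s) = p' * t' - q' * s'"
    unfolding prod[symmetric] by (simp add: algebra_simps)
  then have "m * (u * (a * d - b * c)) = m * u'" unfolding det by (simp add: mult_ac)
  then have "u * (a * d - b * c) = u'" using m by simp
  then have "v' * u * (a * d - b * c) = 1" using u(2) by (simp add: mult.assoc)
  then have "A_mat a b c d \<in> Gamma0 N"
    by (intro Gamma0I) (simp_all add: N mem_principal_ideal c_def)
  moreover have "A_mat p' q' s' t' = A_mat a b c d ** A_mat p q s t"
    by (simp add: A_mat_mult prod)
  ultimately show ?thesis by blast
qed

text \<open>The map f factors through \<open>key\<close>; \<open>SOME\<close> chooses one element in
  each fibre.\<close>

lemma finite_image_by_key: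
  assumes "finite K" "\<And>x. x \<in> S \<Longrightarrow> key x \<in> K"
    and "\<And>x y. x \<in> S \<Longrightarrow> y \<in> S \<Longrightarrow> key x = key y \<Longrightarrow> f x = f y"
  shows "finite (f ` S)"
proof (rule finite_surj[OF assms(1)], rule image_subsetI)
  fix x assume x: "x \<in> S"
  have *: "(SOME y. y \<in> S \<and> key y = key x) \<in> S \<and> key (SOME y. y \<in> S \<and> key y = key x) = key x"
    by (rule someI[where P = "\<lambda>y. y \<in> S \<and> key y = key x" and x = x]) (simp add: x)
  show "f x \<in> (\<lambda>k. f (SOME y. y \<in> S \<and> key y = k)) ` K"
  proof (rule image_eqI)
    show "f x = f (SOME y. y \<in> S \<and> key y = key x)"
      using * by (intro assms(3) x) (simp_all only:)
  qed (rule assms(2)[OF x])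
qed

text \<open>If g e = h r with r from finitely many orbit representatives, then e = adj(g) h r up to
  a scalar. The matrix adj(g) h has determinant a unit times m, so by \<open>Gamma0_of_cong\<close>
  its entries modulo m n determine it up to a left factor in Gamma_0(n). Hence r and these residues
  are a finite key for the orbit of e.\<close>

lemma finite_orbits_preimage:
  fixes N P :: "'a::{field, finite} poly set"
  assumes N: "nonzero_ideal N" and P: "nonzero_ideal P" and g: "g \<in> S_mats N P"
    and fin: "finite (orbit N ` X)"
  shows "finite (orbit N ` {e. act g e \<in> X})"
proof -
  obtain n where n: "monic n" "N = principal_ideal n" using N by (rule nonzero_ideal_generator)
  obtain m where m: "monic m" "P = principal_ideal m" using P by (rule nonzero_ideal_generator)
  obtain a b d where g': "g = A_mat a b 0 d" "a * d = m"
    using g m(1) unfolding m(2) n by (auto simp: S_mats_principal)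
  have m0: "m \<noteq> 0" "m * n \<noteq> 0" using m n by (auto dest: monic_nonzero)
  obtain R where R: "finite R" "orbit N ` X = orbit N ` R"
    using finite_subset_image[OF fin order.refl] by blast
  \<comment> \<open>The scalar m acts trivially on edges, so the adjugate undoes g there while
    keeping entries in A.\<close>
  have adj: "A_mat d (- b) 0 a ** g = mat (of_A m)"
    unfolding A_mat_scalar[symmetric] g' A_mat_mult by (simp add: g'(2)[symmetric] mult.commute)
  have inv: "invertible g" "invertible (A_mat d (- b) 0 a)"
    using g' m0 by (auto simp: invertible_A_mat mult.commute)
  have "\<exists>r p q s t u v. r \<in> R \<and> e = act (A_mat p q s t) r \<and> p * t - q * s = u * m \<and> v * u = 1"
    if hyp: "act g e \<in> X" for e
  proof -
    have "orbit N (act g e) \<in> orbit N ` R"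
      unfolding R(2)[symmetric] using hyp by (rule imageI)
    then obtain r where r: "r \<in> R" "orbit N (act g e) = orbit N r" by blast
    then have "act g e \<in> orbit N r" using mem_orbit[OF N, of "act g e"] by simp
    then obtain h where h: "h \<in> Gamma0 N" "act g e = act h r" by (auto simp: orbit_def)
    then obtain a' b' c' d' v where h': "h = A_mat a' b' c' d'" "v * (a' * d' - b' * c') = 1"
      by (blast elim: Gamma0E)
    have "e = act (mat (of_A m)) e" using m0 by (simp add: act_scalar)
    also have "\<dots> = act (A_mat d (- b) 0 a ** h) r"
      using inv h(2) Gamma0_invertible[OF h(1)] by (simp add: adj[symmetric] act_mult)
    finally have "e = act (A_mat d (- b) 0 a ** h) r" .
    moreover have "(d * a' + - b * c') * (0 * b' + a * d') - (d * b' + - b * d') * (0 * a' + a * c') =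
        (a' * d' - b' * c') * m"
      unfolding g'(2)[symmetric] by (simp add: algebra_simps)
    ultimately show ?thesis using r(1) h'(2) unfolding h'(1) A_mat_mult by blast
  qed
  then obtain r p q s t u v where *: "\<And>e. e \<in> {e. act g e \<in> X} \<Longrightarrow>
      r e \<in> R \<and> e = act (A_mat (p e) (q e) (s e) (t e)) (r e) \<and>
      p e * t e - q e * s e = u e * m \<and> v e * u e = 1"
    unfolding mem_Collect_eq by metis
  let ?B = "polys_below (degree (m * n)) :: 'a poly set"
  show ?thesis
  proof (rule finite_image_by_key[where K = "R \<times> ?B \<times> ?B \<times> ?B \<times> ?B"
      and key = "\<lambda>e. (r e, p e mod (m * n), q e mod (m * n), s e mod (m * n), t e mod (m * n))"])
    show "finite (R \<times> ?B \<times> ?B \<times> ?B \<times> ?B)" using R(1) by simp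
    have "x mod (m * n) \<in> ?B" for x using degree_mod_less[OF m0(2)] by (auto simp: polys_below_iff)
    then show "(r e, p e mod (m * n), q e mod (m * n), s e mod (m * n), t e mod (m * n)) \<in> R \<times> ?B \<times> ?B \<times> ?B \<times> ?B"
      if "e \<in> {e. act g e \<in> X}" for e
      using *[OF that] by simp
  next
    fix e e' assume e: "e \<in> {e. act g e \<in> X}" "e' \<in> {e. act g e \<in> X}"
      and key: "(r e, p e mod (m * n), q e mod (m * n), s e mod (m * n), t e mod (m * n)) =
        (r e', p e' mod (m * n), q e' mod (m * n), s e' mod (m * n), t e' mod (m * n))"
    note e1 = *[OF e(1)] and e2 = *[OF e(2)]
    have "\<exists>h\<in>Gamma0 N. A_mat (p e') (q e') (s e') (t e') = h ** A_mat (p e) (q e) (s e) (t e)"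
      using e1 e2 key by (intro Gamma0_of_cong[OF n(2) m0(1)]) (auto simp flip: mod_eq_dvd_iff)
    then obtain h where h: "h \<in> Gamma0 N" "A_mat (p e') (q e') (s e') (t e') = h ** A_mat (p e) (q e) (s e) (t e)"
      by blast
    have "invertible (A_mat (p e) (q e) (s e) (t e))"
      using e1 m0 by (auto simp: invertible_A_mat)
    then have "e' = act h e"
      using e1 e2 key h Gamma0_invertible[OF h(1)] by (metis act_mult prod.inject)
    then show "orbit N e = orbit N e'" using orbit_act[OF N h(1)] by simp
  qed
qed

lemma hecke_H0:
  fixes N P :: "'a::{field, finite} poly set"
  assumes N: "nonzero_ideal N" and P: "nonzero_ideal P" and F: "F \<in> H0 N"
  shows "hecke N P F \<in> H0 N"
proof -
  have F': "harmonic F" "\<And>h e. h \<in> Gamma0 N \<Longrightarrow> F (act h e) = F e" "finite (orbit N ` {e. F e \<noteq> 0})"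
    using F by (auto simp: H0_def)
  have "{e. hecke N P F e \<noteq> 0} \<subseteq> (\<Union>g\<in>S_mats N P. {e. act g e \<in> {e. F e \<noteq> 0}})"
    unfolding hecke_def by (auto intro: sum.neutral)
  then have "orbit N ` {e. hecke N P F e \<noteq> 0} \<subseteq> (\<Union>g\<in>S_mats N P. orbit N ` {e. act g e \<in> {e. F e \<noteq> 0}})"
    by blast
  then have "finite (orbit N ` {e. hecke N P F e \<noteq> 0})"
    by (rule finite_subset) (intro finite_UN_I finite_S_mats[OF N P] finite_orbits_preimage[OF N P _ F'(3)])
  then show ?thesis
    using hecke_harmonic[OF P F'(1)] hecke_invariant[OF N P F'(2)] by (simp add: H0_def)
qed

lemma H0_zero: "(\<lambda>e. 0) \<in> H0 N"
  by (simp add: H0_def harmonic_def)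

lemma H0_lincomb:
  assumes "F \<in> H0 N" "G \<in> H0 N"
  shows "(\<lambda>e. r * F e + s * G e) \<in> H0 N"
proof -
  have "harmonic (\<lambda>e. r * F e + s * G e)"
    using assms unfolding H0_def harmonic_def
    by (auto simp: sum.distrib algebra_simps simp flip: sum_distrib_left distrib_left)
  moreover have "{e. r * F e + s * G e \<noteq> 0} \<subseteq> {e. F e \<noteq> 0} \<union> {e. G e \<noteq> 0}" by auto
  then have "orbit N ` {e. r * F e + s * G e \<noteq> 0} \<subseteq> orbit N ` {e. F e \<noteq> 0} \<union> orbit N ` {e. G e \<noteq> 0}"
    by blast
  ultimately show ?thesis
    using assms by (auto simp: H0_def elim: finite_subset)
qed

lemma H0_sum:
  assumes "\<And>i. i \<in> I \<Longrightarrow> F i \<in> H0 N"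
  shows "(\<lambda>e. \<Sum>i\<in>I. r i * F i e) \<in> H0 N"
  using assms
proof (induction I rule: infinite_finite_induct)
  case (insert i I)
  then have "(\<lambda>e. r i * F i e + 1 * (\<Sum>i\<in>I. r i * F i e)) \<in> H0 N" by (intro H0_lincomb) auto
  then show ?case using insert by simp
qed (simp_all add: H0_zero)

section \<open>Values of a cuspidal cochain\<close>

locale cuspidal_cochain =
  fixes N :: "'a::{field, finite} poly set" and F :: "'a edge \<Rightarrow> int"
  assumes nonzero_N: "nonzero_ideal N" and F_in_H0: "F \<in> H0 N"
begin

abbreviation E :: "int \<Rightarrow> 'a fls \<Rightarrow> int" where
  "E k y \<equiv> F (edge_at k y)"

lemma F_invariant: "h \<in> Gamma0 N \<Longrightarrow> F (act h e) = F e"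
  using F_in_H0 by (simp add: H0_def)

lemma E_harmonic: "E k y = (\<Sum>t\<in>UNIV. E (k + 1) (y + fls_const t * fls_X_intpow k))"
  using F_in_H0 by (intro harmonic_edge_at) (simp add: H0_def)

lemma E_cong: "y' - y \<in> pi_ideal k \<Longrightarrow> E k y = E k y'"
  using edge_at_cong by metis

lemma E_add_of_A: "E k (y + of_A f) = E k y"
proof -
  have "A_mat 1 f 0 1 \<in> Gamma0 N"
    using nonzero_N by (intro Gamma0I[where v = 1]) (simp_all add: nonzero_ideal_iff)
  moreover from this have "act (A_mat 1 f 0 1) (edge_at k y) = edge_at k (y + of_A f)"
    unfolding edge_at_def by (subst act_abs_edge[OF Gamma0_invertible])
      (simp_all add: invertible_mat2 A_mat_def mat2_mult)
  ultimately show ?thesis using F_invariant by metis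
qed

lemma E_const_mult:
  assumes "c \<noteq> 0"
  shows "E k (fls_const c * y) = E k y"
proof -
  have "A_mat [:c:] 0 0 1 \<in> Gamma0 N"
    using nonzero_N assms by (intro Gamma0I[where v = "[:inverse c:]"]) (simp_all add: nonzero_ideal_iff one_pCons)
  moreover from this have "act (A_mat [:c:] 0 0 1) (edge_at k y) =
      abs_edge (mat2 (fls_const c * fls_X_intpow k) (fls_const c * y) 0 1)"
    unfolding edge_at_def by (subst act_abs_edge[OF Gamma0_invertible])
      (simp_all add: invertible_mat2 A_mat_def mat2_mult of_A_const)
  moreover have "\<dots> = edge_at k (fls_const c * y)"
    using assms by (subst abs_edge_upper) (simp_all add: fls_shift_eq0_iff)
  ultimately show ?thesis using F_invariant by metis
qed

lemma finite_range_F: "finite (range F)"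
proof -
  have "F ` {e. F e \<noteq> 0} \<subseteq> (\<lambda>X. F (SOME e. e \<in> X)) ` (orbit N ` {e. F e \<noteq> 0})"
  proof (rule image_subsetI)
    fix e assume e: "e \<in> {e. F e \<noteq> 0}"
    have "(SOME e'. e' \<in> orbit N e) \<in> orbit N e" using mem_orbit[OF nonzero_N] by (rule someI)
    then have "F (SOME e'. e' \<in> orbit N e) = F e" using F_invariant by (auto simp: orbit_def)
    then show "F e \<in> (\<lambda>X. F (SOME e. e \<in> X)) ` (orbit N ` {e. F e \<noteq> 0})"
      using imageI[OF e, of "orbit N"] by (rule image_eqI[OF sym])
  qed
  moreover have "finite (orbit N ` {e. F e \<noteq> 0})" using F_in_H0 by (simp add: H0_def)
  ultimately have "finite (insert 0 (F ` {e. F e \<noteq> 0}))" by (simp add: finite_surj)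
  moreover have "range F \<subseteq> insert 0 (F ` {e. F e \<noteq> 0})" by auto
  ultimately show ?thesis by (rule finite_subset[rotated])
qed

text \<open>Going towards the cusp $\infty$, harmonicity multiplies the values by $q$, whereas a cuspidal
  cochain takes only finitely many values.\<close>

lemma E_eq_0:
  assumes "k \<le> 1"
  shows "E k y = 0"
proof -
  have E0: "E k y = E k 0" if k: "k \<le> 1" for k y
  proof -
    obtain f where "y - of_A f \<in> pi_ideal 1" using ex_of_A_approx by blast
    then have "E k (of_A f) = E k y" using k by (intro E_cong) (rule pi_ideal_antimono)
    then show ?thesis using E_add_of_A[of k 0 f] by simp
  qed
  \<comment> \<open>For k at most 0 the q edges on the right have level at most 1, where
    \<open>E0\<close> makes the upper right entry irrelevant; so all q summands agree.\<close>
  have step: "E k 0 = int CARD('a) * E (k + 1) 0" if "k \<le> 0" for k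
  proof -
    have "E k 0 = (\<Sum>t\<in>(UNIV :: 'a set). E (k + 1) 0)"
      unfolding E_harmonic[of k 0] using that by (intro sum.cong E0) auto
    then show ?thesis by simp
  qed
  have pow: "E (1 - int n) 0 = int CARD('a) ^ n * E 1 0" for n
  proof (induction n)
    case (Suc n)
    have "E (1 - int (Suc n)) 0 = int CARD('a) * E (1 - int n) 0"
      using step[of "1 - int (Suc n)"] by simp
    then show ?case using Suc by simp
  qed simp
  have B: "\<bar>F e\<bar> \<le> Max (abs ` range F)" for e
    using finite_range_F by (intro Max_ge) auto
  define B where "B = Max (abs ` range F)"
  have "CARD('a) \<ge> 2"
    using card_mono[of UNIV "{0, 1 :: 'a}"] by simp
  have "E 1 0 = 0"
  proof (rule ccontr)
    assume nz: "E 1 0 \<noteq> 0"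
    \<comment> \<open>The contradiction arises at level 1 - B: the absolute value there is at least
      q^B, which exceeds the bound B.\<close>
    have "2 ^ nat B \<le> int CARD('a) ^ nat B" using \<open>CARD('a) \<ge> 2\<close> by (intro power_mono) auto
    also have "\<dots> \<le> int CARD('a) ^ nat B * \<bar>E 1 0\<bar>" using nz by (simp add: mult_le_cancel_left1)
    also have "\<dots> = \<bar>E (1 - int (nat B)) 0\<bar>" by (simp only: pow abs_mult power_abs abs_of_nat)
    also have "\<dots> \<le> B" unfolding B_def by (rule B)
    finally have "2 ^ nat B \<le> B" .
    moreover have "int (nat B) < 2 ^ nat B" by (metis of_nat_less_two_power)
    ultimately show False by linarith
  qed
  moreover have "E k 0 = int CARD('a) ^ nat (1 - k) * E 1 0" using pow[of "nat (1 - k)"] assms by simp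
  ultimately show ?thesis using E0[OF assms] by simp
qed

subsection \<open>Sums over $b$ modulo $d$\<close>

text \<open>Harmonicity at y/d has increments t pi^(k+j). As d is monic of degree j, pi^k/d has
  leading term pi^(k+j), and the error lies in pi^(k+1+j) O_inf, which the next level does not
  see.\<close>

lemma scaled_harmonic:
  assumes d: "monic d" and "j = int (degree d)"
  shows "E (k + j) (y / of_A d) = (\<Sum>t\<in>UNIV. E (k + 1 + j) ((y + fls_const t * fls_X_intpow k) / of_A d))"
proof -
  let ?d = "of_A d" and ?pi = "fls_X_intpow :: int \<Rightarrow> 'a fls"
  have d0: "?d \<noteq> 0" and sub: "fls_subdegree ?d = - j"
    using d assms(2) by (auto simp: fls_subdegree_of_A dest: monic_nonzero)
  have "1 - ?pi j * ?d \<in> pi_ideal 1"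
    using d assms(2) by (auto simp: pi_ideal_def fls_X_intpow_times_conv_shift fls_nth_of_A monic_def coeff_eq_0)
  from pi_ideal_mult[OF intpow_in_pi_ideal[OF order.refl, of k] this]
  have "?pi k * (1 - ?pi j * ?d) / ?d \<in> pi_ideal (k + 1 + j)"
    using pi_ideal_divide[OF _ d0] sub by fastforce
  moreover have "?pi k * (1 - ?pi j * ?d) / ?d = ?pi k / ?d - ?pi (k + j)"
    using d0 by (simp add: diff_divide_distrib right_diff_distrib fls_X_intpow_times_fls_X_intpow mult.assoc[symmetric])
  ultimately have *: "?pi k / ?d - ?pi (k + j) \<in> pi_ideal (k + 1 + j)" by simp
  have "E (k + j + 1) (y / ?d + fls_const t * ?pi (k + j)) = E (k + 1 + j) ((y + fls_const t * ?pi k) / ?d)" for t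
  proof -
    have "(y + fls_const t * ?pi k) / ?d - (y / ?d + fls_const t * ?pi (k + j)) = fls_const t * (?pi k / ?d - ?pi (k + j))"
      by (simp add: add_divide_distrib algebra_simps)
    also have "\<dots> \<in> pi_ideal (0 + (k + 1 + j))" by (intro pi_ideal_mult * const_in_pi_ideal order.refl)
    finally show ?thesis by (subst E_cong) (simp_all add: ac_simps)
  qed
  then show ?thesis by (subst E_harmonic) simp
qed

text \<open>The coefficients of b below T^m change the argument only within pi^(1-m+j) O_inf and
  contribute the factor q^m. Each further coefficient, at T^m up to T^(n-1), lowers the level by one
  through \<open>scaled_harmonic\<close>.\<close>

lemma sum_polys_below_scaled:
  assumes d: "monic d" and j: "j = int (degree d)" and "m \<le> n"
  shows "(\<Sum>b\<in>polys_below n. E (1 - int m + j) ((y + of_A b) / of_A d)) =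
    int CARD('a) ^ m * E (1 - int n + j) (y / of_A d)"
  using \<open>m \<le> n\<close>
proof (induction n arbitrary: y rule: dec_induct)
  case base
  have "E (1 - int m + j) ((y + of_A b) / of_A d) = E (1 - int m + j) (y / of_A d)"
    if b: "b \<in> polys_below m" for b
  proof -
    have "of_A b \<in> pi_ideal (1 - int m)"
    proof (cases "b = 0")
      case False
      then have "int (degree b) < int m" using b by (simp add: polys_below_iff)
      then show ?thesis by (intro pi_ideal_antimono[OF of_A_in_pi_ideal]) simp
    qed simp
    from pi_ideal_divide[OF this, of "of_A d"] have "of_A b / of_A d \<in> pi_ideal (1 - int m + j)"
      using d j by (auto simp: fls_subdegree_of_A dest: monic_nonzero)
    then show ?thesis by (intro E_cong[symmetric]) (simp add: add_divide_distrib)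
  qed
  then show ?case by (simp add: card_polys_below)
next
  case (step n)
  have "(\<Sum>b\<in>polys_below (Suc n). E (1 - int m + j) ((y + of_A b) / of_A d)) =
    (\<Sum>t\<in>UNIV. \<Sum>b\<in>polys_below n. E (1 - int m + j) ((y + fls_const t * fls_X_intpow (- int n) + of_A b) / of_A d))"
    unfolding sum_polys_below_Suc of_A_add of_A_monom by (simp add: ac_simps)
  also have "\<dots> = (\<Sum>t\<in>UNIV. int CARD('a) ^ m * E (1 - int n + j) ((y + fls_const t * fls_X_intpow (- int n)) / of_A d))"
    unfolding step.IH ..
  also have "\<dots> = int CARD('a) ^ m * E (- int n + j) (y / of_A d)"
    unfolding scaled_harmonic[OF d j, of "- int n"] sum_distrib_left by simp
  finally show ?case by simp
qed

text \<open>To be used with i the degree of a. If i - 1 is at most deg d, the sum is q^(i-1) times a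
  value at level 1; otherwise the level of every single term is already at most 1.\<close>

lemma sum_polys_below_eq_0:
  assumes d: "monic d" and "i \<ge> 1"
  shows "(\<Sum>b\<in>polys_below (degree d). E (2 - int i + int (degree d)) ((y + of_A b) / of_A d)) = 0"
proof (cases "i - 1 \<le> degree d")
  case True
  have "2 - int i = 1 - int (i - 1)" using assms(2) by simp
  then show ?thesis
    using sum_polys_below_scaled[OF d refl True, of y] by (simp add: E_eq_0)
next
  case False
  then show ?thesis by (intro sum.neutral ballI E_eq_0) simp
qed

lemma hecke_at_base_edge:
  assumes m: "monic m"
  shows "hecke N (principal_ideal m) F (edge_at 2 fls_X) =
    (\<Sum>b\<in>polys_below (degree m). E (2 + int (degree m)) ((fls_X + of_A b) / of_A m))"
proof -
  obtain n where n: "N = principal_ideal n" using nonzero_N by (blast elim: nonzero_ideal_generator)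
  define D where "D = {(a, d). monic a \<and> monic d \<and> a * d = m \<and> (\<exists>s. n dvd s * a - 1)}"
  have "m \<noteq> 0" using m by (rule monic_nonzero)
  have finD: "finite D"
  proof (rule finite_subset)
    show "D \<subseteq> polys_below (Suc (degree m)) \<times> polys_below (Suc (degree m))"
      using \<open>m \<noteq> 0\<close> by (auto simp: D_def polys_below_iff degree_mult_eq)
  qed simp
  have S: "S_mats N (principal_ideal m) = (\<lambda>((a, d), b). A_mat a b 0 d) ` (SIGMA x:D. polys_below (degree (snd x)))"
    unfolding n S_mats_principal[OF m] D_def by (force simp: image_iff)
  have inj: "inj_on (\<lambda>((a, d), b). A_mat a b 0 d) (SIGMA x:D. polys_below (degree (snd x)))"
    by (auto intro!: inj_onI)
  have act_eq: "act (A_mat a b 0 d) (edge_at 2 fls_X) =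
      edge_at (2 - int (degree a) + int (degree d)) ((of_A a * fls_X + of_A b) / of_A d)"
    if "(a, d) \<in> D" for a b d
  proof -
    have nz: "a \<noteq> 0" "d \<noteq> 0" using that by (auto simp: D_def dest: monic_nonzero)
    then have "invertible (A_mat a b 0 d)" by (simp add: invertible_A_mat)
    from act_abs_edge[OF this invertible_edge_at]
    have "act (A_mat a b 0 d) (edge_at 2 fls_X) = abs_edge (mat2 (of_A a * fls_X_intpow 2) (of_A a * fls_X + of_A b) 0 (of_A d))"
      unfolding edge_at_def by (simp add: A_mat_def mat2_mult)
    also have "\<dots> = edge_at (2 - int (degree a) + int (degree d)) ((of_A a * fls_X + of_A b) / of_A d)"
      using nz by (subst abs_edge_upper) (simp_all add: fls_shift_eq0_iff fls_subdegree_of_A algebra_simps)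
    finally show ?thesis .
  qed
  have "hecke N (principal_ideal m) F (edge_at 2 fls_X) =
      (\<Sum>(a, d)\<in>D. \<Sum>b\<in>polys_below (degree d). F (act (A_mat a b 0 d) (edge_at 2 fls_X)))"
    unfolding hecke_def S sum.reindex[OF inj] using finD
    by (simp add: sum.Sigma split_def o_def)
  also have "\<dots> = (\<Sum>(a, d)\<in>D. \<Sum>b\<in>polys_below (degree d).
      E (2 - int (degree a) + int (degree d)) ((of_A a * fls_X + of_A b) / of_A d))"
    by (intro sum.cong refl) (auto simp: act_eq)
  also have "\<dots> = (\<Sum>(a, d)\<in>{(1, m)}. \<Sum>b\<in>polys_below (degree d).
      E (2 - int (degree a) + int (degree d)) ((of_A a * fls_X + of_A b) / of_A d))"
  proof (rule sum.mono_neutral_right[OF finD])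
    show "{(1, m)} \<subseteq> D" using m by (auto simp: D_def monic_def intro: exI[of _ 1])
    show "\<forall>x\<in>D - {(1, m)}. (case x of (a, d) \<Rightarrow> \<Sum>b\<in>polys_below (degree d).
      E (2 - int (degree a) + int (degree d)) ((of_A a * fls_X + of_A b) / of_A d)) = 0"
    proof
      fix x assume x: "x \<in> D - {(1, m)}"
      obtain a d where ad': "x = (a, d)" by (cases x)
      then have ad: "(a, d) \<in> D" and ne: "(a, d) \<noteq> (1, m)" using x by auto
      \<comment> \<open>A monic polynomial of degree 0 is 1, and a = 1 would force d = m.\<close>
      have "degree a \<noteq> 0"
      proof
        assume "degree a = 0"
        then obtain c where "a = [:c:]" by (rule degree_eq_zeroE)
        then have "a = 1" using ad by (simp add: D_def monic_def one_pCons)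
        then show False using ad ne by (simp add: D_def)
      qed
      then have "(\<Sum>b\<in>polys_below (degree d).
        E (2 - int (degree a) + int (degree d)) ((of_A a * fls_X + of_A b) / of_A d)) = 0"
        using ad by (intro sum_polys_below_eq_0) (auto simp: D_def)
      then show "(case x of (a, d) \<Rightarrow> \<Sum>b\<in>polys_below (degree d).
        E (2 - int (degree a) + int (degree d)) ((of_A a * fls_X + of_A b) / of_A d)) = 0"
        by (simp add: ad')
    qed
  qed
  finally show ?thesis by simp
qed

end

subsection \<open>Counting\<close>

lemma div_eq_0_polys_below: "f \<in> polys_below (degree g) \<Longrightarrow> f div g = (0 :: 'a::field poly)"
  by (auto simp: polys_below_iff div_poly_less)

text \<open>For u = pi^(j+1) v, the coefficient of T^j in v m is the coefficient of pi in u m. So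
  these are the monic m of degree j whose Hecke sum contains the value at u.\<close>

definition hit :: "'a::field poly \<Rightarrow> nat \<Rightarrow> 'a poly set" where
  "hit v j = {m. monic m \<and> degree m = j \<and> coeff (v * m) j = 1}"

text \<open>The fractions $(\pi + b)/m$ modulo $\pi^{j+2}$ are the $u = \pi^{j+1} v$ for which the
  coefficient of $\pi$ in $u m$ is 1.\<close>

lemma sum_fractions:
  fixes h :: "'a::{field, finite} fls \<Rightarrow> 'b::comm_monoid_add"
  assumes m: "monic m" "degree m = j"
    and h: "\<And>x y. y - x \<in> pi_ideal (int j + 2) \<Longrightarrow> h x = h y"
  shows "(\<Sum>b\<in>polys_below j. h ((fls_X + of_A b) / of_A m)) =
    (\<Sum>v | v \<in> polys_below (Suc j) \<and> coeff (v * m) j = 1. h (fls_X_intpow (int j + 1) * of_A v))"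
proof -
  define T :: "nat \<Rightarrow> 'a poly" where "T = monom 1"
  \<comment> \<open>Since pi = T^j / T^(j+1), this is the polynomial part of T^(j+1) (pi + b) /
    m.\<close>
  define \<phi> where "\<phi> b = (T j + T (Suc j) * b) div m" for b
  have m0: "m \<noteq> 0" using m(1) by (rule monic_nonzero)
  have T0: "T k \<noteq> 0" "degree (T k) = k" for k by (simp_all add: T_def degree_monom_eq)
  have rem: "(T j + T (Suc j) * b) mod m \<in> polys_below j" for b
    using degree_mod_less[OF m0] m(2) by (auto simp: polys_below_iff)
  have eq: "\<phi> b * m = T j + T (Suc j) * b - (T j + T (Suc j) * b) mod m" for b
    by (simp add: \<phi>_def minus_mod_eq_div_mult)
  have coeffT: "coeff (T k * b) i = (if i < k then 0 else coeff b (i - k))" for k b i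
    by (simp add: T_def coeff_monom_mult)
  have 1: "\<phi> b * m div T (Suc j) = b" for b
  proof -
    have "T j - (T j + T (Suc j) * b) mod m \<in> polys_below (Suc j)"
      using rem[of b] by (auto simp: polys_below_def T_def)
    then have "(T j - (T j + T (Suc j) * b) mod m) div T (Suc j) = 0"
      by (intro div_eq_0_polys_below) (simp add: T0)
    moreover have "\<phi> b * m = T (Suc j) * b + (T j - (T j + T (Suc j) * b) mod m)" by (simp add: eq)
    ultimately show ?thesis using T0(1) by (simp add: poly_div_add_left)
  qed
  \<comment> \<open>As the coefficient of T^j in v m is 1, v m = T^(j+1) b + T^j + r with deg r < j,
    so division of T^(j+1) b + T^j by m gives back v.\<close>
  have 2: "\<phi> (v * m div T (Suc j)) = v" if "coeff (v * m) j = 1" for v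
  proof -
    define r where "r = v * m mod T (Suc j) - T j"
    have vm: "v * m = T (Suc j) * (v * m div T (Suc j)) + v * m mod T (Suc j)" by simp
    have "v * m mod T (Suc j) \<in> polys_below (Suc j)"
      using degree_mod_less[OF T0(1), of "v * m" "Suc j"] by (auto simp: polys_below_iff T0)
    moreover have "coeff (v * m) j = coeff (T (Suc j) * (v * m div T (Suc j))) j + coeff (v * m mod T (Suc j)) j"
      by (metis coeff_add vm)
    then have "coeff (v * m mod T (Suc j)) j = 1" using that by (simp add: coeffT)
    ultimately have "coeff r i = 0" if "i \<ge> j" for i
      using that by (cases "i = j") (auto simp: polys_below_def r_def T_def)
    then have "r \<in> polys_below j" by (simp add: polys_below_def)
    then have "(- r) div m = 0" using m(2) by (intro div_eq_0_polys_below) (simp add: polys_below_def)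
    moreover have "T j + T (Suc j) * (v * m div T (Suc j)) = v * m + (- r)"
      by (simp add: r_def minus_mod_eq_mult_div[symmetric])
    ultimately show ?thesis using m0 by (simp add: \<phi>_def poly_div_diff_left)
  qed
  show ?thesis
  proof (rule sum.reindex_bij_witness[where i = "\<lambda>v. v * m div T (Suc j)" and j = \<phi>])
    fix b :: "'a poly" assume b: "b \<in> polys_below j"
    show "\<phi> b * m div T (Suc j) = b" by (rule 1)
    have "coeff (\<phi> b * m) j = 1"
      unfolding eq using rem[of b] by (simp add: coeffT polys_below_def) (simp add: T_def)
    moreover have "\<phi> b \<in> polys_below (Suc j)"
    proof (cases "\<phi> b = 0")
      case False
      have "\<phi> b * m \<in> polys_below (Suc (j + j))"
        unfolding eq using rem[of b] b by (auto simp: polys_below_def T_def coeff_monom_mult)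
      then show ?thesis using False m0 m(2) by (simp add: polys_below_iff degree_mult_eq)
    qed (simp add: polys_below_iff)
    ultimately show "\<phi> b \<in> {v. v \<in> polys_below (Suc j) \<and> coeff (v * m) j = 1}" by simp
    let ?r = "(T j + T (Suc j) * b) mod m" and ?pi = "fls_X_intpow (int j + 1) :: 'a fls"
    have pi_T: "?pi * of_A (T k) = fls_X_intpow (int j + 1 + - int k)" for k
      unfolding T_def of_A_monom by (simp only: fls_const_1 mult_1_left fls_X_intpow_times_fls_X_intpow)
    have "?pi * of_A (T j) = fls_X" "?pi * of_A (T (Suc j)) = 1"
      unfolding pi_T by (simp_all add: fls_X_conv_shift_1)
    moreover have "?pi * of_A (\<phi> b) * of_A m = ?pi * of_A (T j) + ?pi * of_A (T (Suc j)) * of_A b - ?pi * of_A ?r"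
      by (simp add: mult.assoc eq of_A_add of_A_diff of_A_mult right_diff_distrib distrib_left flip: of_A_mult[of "\<phi> b"])
    ultimately have "?pi * of_A (\<phi> b) = (fls_X + of_A b - ?pi * of_A ?r) / of_A m"
      using m0 by (simp add: eq_divide_eq)
    then have "(fls_X + of_A b) / of_A m - ?pi * of_A (\<phi> b) = ?pi * of_A ?r / of_A m"
      by (simp add: diff_divide_distrib)
    \<comment> \<open>The remainder has degree at most j - 1, so the orders add up to at least (j +
      1) + (1 - j) + j = j + 2.\<close>
    also have "\<dots> \<in> pi_ideal (int j + 2)"
    proof -
      have "of_A ?r \<in> pi_ideal (1 - int j)"
      proof (cases "?r = 0")
        case False
        then have "int (degree ?r) < int j" using rem[of b] by (simp add: polys_below_iff)
        then show ?thesis by (intro pi_ideal_antimono[OF of_A_in_pi_ideal]) simp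
      qed simp
      from pi_ideal_divide[OF pi_ideal_mult[OF intpow_in_pi_ideal[OF order.refl, of "int j + 1"] this], of "of_A m"]
      show ?thesis using m0 m(2) by (simp add: fls_subdegree_of_A ac_simps)
    qed
    finally show "h (?pi * of_A (\<phi> b)) = h ((fls_X + of_A b) / of_A m)" by (rule h)
  next
    fix v :: "'a poly" assume v: "v \<in> {v. v \<in> polys_below (Suc j) \<and> coeff (v * m) j = 1}"
    then show "\<phi> (v * m div T (Suc j)) = v" by (intro 2) simp
    have "v * m \<in> polys_below (Suc (j + j))"
      using v m(2) m0 by (cases "v = 0") (auto simp: polys_below_iff degree_mult_eq)
    then show "v * m div T (Suc j) \<in> polys_below j"
    proof (cases "v * m div T (Suc j) = 0")
      case False
      let ?w = "v * m div T (Suc j)"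
      have "degree (T (Suc j) * ?w) = Suc j + degree ?w"
        using False T0 by (simp add: degree_mult_eq)
      moreover have "degree (v * m mod T (Suc j)) < Suc j"
        using degree_mod_less'[of "T (Suc j)" "v * m"] T0 by (cases "v * m mod T (Suc j) = 0") auto
      ultimately have "degree (T (Suc j) * ?w + v * m mod T (Suc j)) = Suc j + degree ?w"
        by (subst degree_add_eq_left) simp_all
      then have "degree (v * m) = Suc j + degree ?w" by simp
      then show ?thesis using \<open>v * m \<in> polys_below (Suc (j + j))\<close> by (auto simp: polys_below_iff)
    qed (simp add: polys_below_iff)
  qed
qed

text \<open>D is a disjoint union of affine lines in direction \<delta>, each with q points.\<close>

lemma card_dvd_of_translation_invariant:
  fixes D :: "'a::{field, finite} poly set"
  assumes fin: "finite D" and "\<delta> \<noteq> 0" and D: "\<And>x c. x \<in> D \<Longrightarrow> x + smult c \<delta> \<in> D"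
  shows "CARD('a) dvd card D"
proof -
  let ?L = "\<lambda>x. range (\<lambda>c. x + smult c \<delta>)"
  have self: "x \<in> ?L x" for x by (rule range_eqI[of _ _ 0]) simp
  have un: "\<Union> (?L ` D) = D"
  proof
    show "\<Union> (?L ` D) \<subseteq> D" using D by auto
    show "D \<subseteq> \<Union> (?L ` D)"
    proof
      fix x assume "x \<in> D"
      then show "x \<in> \<Union> (?L ` D)" by (rule UN_I) (rule self)
    qed
  qed
  have "CARD('a) dvd card (\<Union> (?L ` D))"
  proof (rule dvd_partition)
    show "finite (\<Union> (?L ` D))" using fin un by simp
    have "inj (\<lambda>c. x + smult c \<delta>)" for x
    proof
      fix c c' assume "x + smult c \<delta> = x + smult c' \<delta>"
      then have "smult (c - c') \<delta> = 0" by (simp add: smult_diff_left)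
      then show "c = c'" using assms(2) by simp
    qed
    then have "card (?L x) = CARD('a)" for x by (rule card_image)
    then show "\<forall>c\<in>?L ` D. CARD('a) dvd card c" by auto
    have "?L x = ?L y" if meet: "?L x \<inter> ?L y \<noteq> {}" for x y
    proof -
      obtain c c' where c: "x + smult c \<delta> = y + smult c' \<delta>" using meet by auto
      then have "x = y + smult (c' - c) \<delta>" by (simp add: smult_diff_left algebra_simps)
      then have 1: "x + smult t \<delta> = y + smult (t + c' - c) \<delta>"
        and 2: "y + smult t \<delta> = x + smult (t - (c' - c)) \<delta>" for t
        by (simp_all add: smult_diff_left smult_add_left)
      have "?L x \<subseteq> ?L y" by (rule image_subsetI) (subst 1, rule rangeI)
      moreover have "?L y \<subseteq> ?L x" by (rule image_subsetI) (subst 2, rule rangeI)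
      ultimately show ?thesis by (rule equalityI)
    qed
    then show "\<forall>c1\<in>?L ` D. \<forall>c2\<in>?L ` D. c1 \<noteq> c2 \<longrightarrow> c1 \<inter> c2 = {}"
      unfolding ball_simps by metis
  qed
  then show ?thesis unfolding un .
qed

lemma finite_hit: "finite (hit (v :: 'a::{field, finite} poly) j)"
  by (rule finite_subset[OF _ finite_monic_degree[of j]]) (auto simp: hit_def)

text \<open>On the plane spanned by 1 and T, the functional sending m to the coefficient of T^j in v
  m has a nonzero kernel vector \<delta>. Since j is at least 2, adding multiples of \<delta>
  changes neither degree nor leading coefficient.\<close>

lemma card_hit_dvd:
  fixes v :: "'a::{field, finite} poly"
  assumes "j \<ge> 2"
  shows "CARD('a) dvd card (hit v j)"
proof -
  obtain i where i: "j = Suc i" using assms by (cases j) auto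
  obtain x0 x1 where x: "x0 * coeff v j + x1 * coeff v i = 0" "x0 \<noteq> 0 \<or> x1 \<noteq> 0"
  proof (cases "coeff v j = 0 \<and> coeff v i = 0")
    case True
    then show thesis using that[of 1 0] by simp
  next
    case False
    then show thesis using that[of "coeff v i" "- coeff v j"] by auto
  qed
  define \<delta> where "\<delta> = [:x0, x1:]"
  have "degree \<delta> < j" using assms by (simp add: \<delta>_def)
  moreover have "coeff (v * \<delta>) j = 0"
    using x(1) by (simp add: \<delta>_def i mult.commute)
  ultimately have "m + smult c \<delta> \<in> hit v j" if "m \<in> hit v j" for m c
  proof -
    have "degree (smult c \<delta>) < degree m" "coeff \<delta> j = 0"
      using that \<open>degree \<delta> < j\<close> degree_smult_le[of c \<delta>] by (auto simp: hit_def coeff_eq_0)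
    then show ?thesis
      using that \<open>coeff (v * \<delta>) j = 0\<close> by (auto simp: hit_def monic_def degree_add_eq_left distrib_left)
  qed
  moreover have "\<delta> \<noteq> 0" using x(2) by (auto simp: \<delta>_def)
  ultimately show ?thesis using card_dvd_of_translation_invariant[OF finite_hit] by blast
qed

lemma monic_linear: "monic m \<and> degree m = 1 \<longleftrightarrow> (\<exists>c. m = [:c, 1 :: 'a::field:])"
proof
  assume "monic m \<and> degree m = 1"
  then show "\<exists>c. m = [:c, 1:]"
    by (intro exI[of _ "coeff m 0"]) (auto simp: monic_def poly_eq_iff coeff_pCons coeff_eq_0 split: nat.split)
qed (auto simp: monic_def)

text \<open>For m = T + c the condition is t + s c = 1. It has one solution c if s is nonzero, and q
  or no solutions if s = 0.\<close>

lemma card_hit_linear: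
  fixes s t :: "'a::{field, finite}"
  shows "int CARD('a) dvd int (card (hit [:t, s:] 1)) - (if s = 0 then 0 else 1)"
proof -
  have hit: "hit [:t, s:] 1 = (\<lambda>c. [:c, 1:]) ` {c. t + s * c = 1}"
  proof -
    have "hit [:t, s:] 1 = {m. (\<exists>c. m = [:c, 1:]) \<and> coeff ([:t, s:] * m) 1 = 1}"
      unfolding hit_def monic_linear[symmetric] by simp
    also have "\<dots> = (\<lambda>c. [:c, 1:]) ` {c. t + s * c = 1}" by (auto simp: algebra_simps)
    finally show ?thesis .
  qed
  have "inj (\<lambda>c :: 'a. [:c, 1:])" by (auto intro: injI)
  then have card: "card (hit [:t, s:] 1) = card {c. t + s * c = 1}"
    unfolding hit by (metis card_image inj_on_subset subset_UNIV)
  show ?thesis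
  proof (cases "s = 0")
    case True
    then have "{c. t + s * c = 1} = (if t = 1 then UNIV else {})" by auto
    then show ?thesis using True unfolding card by simp
  next
    case False
    then have "{c. t + s * c = 1} = {(1 - t) / s}" by (auto simp: field_simps)
    then show ?thesis using False unfolding card by simp
  qed
qed

section \<open>The trace of a finite field\<close>

lemma CHAR_dvd_card_UNIV: "CHAR('a :: {ring_1, finite}) dvd CARD('a)"
proof -
  have "(\<Sum>x\<in>UNIV. x + 1 :: 'a) = (\<Sum>x\<in>UNIV. x)"
    by (rule sum.reindex_bij_witness[where i = "\<lambda>x. x - 1" and j = "\<lambda>x. x + 1"]) auto
  then have "of_nat CARD('a) = (0 :: 'a)" by (simp add: sum.distrib)
  then show ?thesis by (simp add: of_nat_eq_0_iff_char_dvd)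
qed

lemma CHAR_finite_field:
  assumes "prime p" "CARD('a :: finite_field) = p ^ r"
  shows "CHAR('a) = p"
proof -
  have "CHAR('a) dvd p" using CHAR_dvd_card_UNIV[where 'a = 'a] assms(2) prime_dvd_power[OF CHAR_prime] by metis
  then show ?thesis using assms(1) CHAR_prime primes_dvd_imp_eq by blast
qed

text \<open>The polynomial X^p - X has at most p roots, and the p images of natural numbers below p
  already are roots.\<close>

lemma fixed_by_Frobenius:
  assumes "(x :: 'a::finite_field) ^ CHAR('a) = x"
  shows "\<exists>k::nat. x = of_nat k"
proof -
  let ?p = "CHAR('a)"
  have p: "?p \<ge> 2" using CHAR_prime[where 'a = 'a] by (simp add: prime_ge_2_nat)
  let ?f = "monom 1 ?p + monom (- 1) 1 :: 'a poly"
  have f: "poly ?f y = y ^ ?p - y" for y by (simp add: poly_monom)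
  have deg: "degree ?f = ?p" using p by (simp add: degree_add_eq_left degree_monom_eq)
  then have "?f \<noteq> 0" using p by (metis degree_0 not_numeral_le_zero)
  have "(of_nat k :: 'a) ^ ?p = of_nat k" for k
  proof (induction k)
    case (Suc k)
    then show ?case by (simp add: freshmans_dream)
  qed (use p in simp)
  then have "of_nat ` {..<?p} \<subseteq> {y. poly ?f y = 0}" by (auto simp: poly_monom)
  moreover have "card (of_nat ` {..<?p} :: 'a set) = ?p"
  proof -
    have "inj_on (of_nat :: nat \<Rightarrow> 'a) {..<?p}"
    proof (rule linorder_inj_onI)
      fix m n :: nat assume "m < n" "m \<in> {..<?p}" "n \<in> {..<?p}"
      then show "(of_nat m :: 'a) \<noteq> of_nat n"
        by (auto simp: of_nat_eq_iff_char_dvd dest: dvd_imp_le)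
    qed auto
    then show ?thesis by (simp add: card_image)
  qed
  ultimately have "of_nat ` {..<?p} = {y. poly ?f y = 0}"
    using card_poly_roots_bound[OF \<open>?f \<noteq> 0\<close>] deg poly_roots_finite[OF \<open>?f \<noteq> 0\<close>]
    by (intro card_seteq) auto
  then have "x \<in> of_nat ` {..<?p}" using assms f by simp
  then show ?thesis by blast
qed

lemma ex_of_nat_prime_field:
  assumes "prime CARD('f :: finite_field)"
  shows "\<exists>k::nat. (x :: 'f) = of_nat k"
proof (rule fixed_by_Frobenius)
  have "CHAR('f) = CARD('f)" using CHAR_finite_field[OF assms, where r = 1 and 'a = 'f] by simp
  then show "x ^ CHAR('f) = x" by (simp add: finite_field_power_card_eq_same)
qed

locale trace_to_prime_field =
  fixes p r :: nat and a_type :: "'a::finite_field itself" and f_type :: "'f::finite_field itself"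
  assumes p: "prime p" and card_a: "CARD('a) = p ^ r" and card_f: "CARD('f) = p"
begin

lemma CHAR_a: "CHAR('a) = p"
  using CHAR_finite_field[OF p card_a] .

lemma CHAR_f: "CHAR('f) = p"
  using CHAR_finite_field[OF p, where r = 1 and 'a = 'f] card_f by simp

lemma prime_degree: "prime_degree TYPE('a) = r"
  unfolding prime_degree_def CHAR_a card_a
  using prime_gt_1_nat[OF p] by (intro the_equality) (auto dest: power_inject_exp[THEN iffD1, rotated])

text \<open>The trace with values still in the large field; \<open>trace_Fp\<close> moves it to the
  other type through integer representatives.\<close>

definition tr :: "'a \<Rightarrow> 'a" where
  "tr x = (\<Sum>i<r. x ^ (p ^ i))"

lemma tr_add: "tr (x + y) = tr x + tr y"
proof -
  have "(x + y) ^ (p ^ i) = x ^ (p ^ i) + y ^ (p ^ i)" for i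
    using freshmans_dream'[of "p ^ i" i x y] by (simp add: CHAR_a[symmetric])
  then show ?thesis by (simp add: tr_def sum.distrib)
qed

lemma tr_fixed: "tr x ^ p = tr x"
proof -
  have "tr x ^ p = (\<Sum>i<r. (x ^ (p ^ i)) ^ p)"
    unfolding tr_def by (rule freshmans_dream_sum) (simp_all flip: CHAR_a)
  also have "\<dots> = (\<Sum>i<r. x ^ (p ^ Suc i))"
    by (simp add: power_mult[symmetric] mult.commute)
  \<comment> \<open>The p-th power shifts the exponents by one. Adding x completes the sum over i =
    0, ..., r, whose last term x^(p^r) is again x.\<close>
  finally have "tr x ^ p + x ^ (p ^ 0) = (\<Sum>i<Suc r. x ^ (p ^ i))"
    by (subst sum.lessThan_Suc_shift) simp
  also have "\<dots> = tr x + x"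
    using finite_field_power_card_eq_same[of x] by (simp add: tr_def card_a)
  finally show ?thesis by simp
qed

abbreviation tr_f :: "'a \<Rightarrow> 'f" where
  "tr_f \<equiv> trace_Fp"

text \<open>Both fields have characteristic p. This makes the identification of prime fields, and
  hence the \<open>THE\<close> in \<open>trace_Fp\<close>, well defined.\<close>

lemma of_int_eq_iff_transfer: "of_int k = (of_int l :: 'a) \<longleftrightarrow> of_int k = (of_int l :: 'f)"
  using of_int_eq_0_iff_char_dvd[of "k - l", where 'a = 'a] of_int_eq_0_iff_char_dvd[of "k - l", where 'a = 'f]
  by (simp add: CHAR_a CHAR_f)

lemma trace_Fp_eqI:
  assumes "of_int k = tr x"
  shows "tr_f x = of_int k"
  unfolding trace_Fp_def prime_degree CHAR_a tr_def[symmetric]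
  using assms of_int_eq_iff_transfer by (intro the_equality) metis+

lemma trace_Fp_witness: obtains k where "of_int k = tr x" "tr_f x = of_int k"
proof -
  obtain k where "tr x = of_nat k" using fixed_by_Frobenius[of "tr x"] tr_fixed by (auto simp: CHAR_a)
  then show thesis using that[of "int k"] trace_Fp_eqI[of "int k" x] by simp
qed

lemma trace_Fp_add: "tr_f (x + y) = tr_f x + tr_f y"
proof -
  obtain k where k: "of_int k = tr x" "tr_f x = of_int k" by (rule trace_Fp_witness)
  obtain l where l: "of_int l = tr y" "tr_f y = of_int l" by (rule trace_Fp_witness)
  show ?thesis using k l by (subst trace_Fp_eqI[of "k + l"]) (simp_all add: tr_add)
qed

lemma trace_Fp_0: "tr_f 0 = 0"
  using trace_Fp_add[of 0 0] by (metis add.right_neutral add_left_imp_eq)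

lemma trace_Fp_of_nat: "tr_f (of_nat n * x) = of_nat n * tr_f x"
  by (induction n) (simp_all add: trace_Fp_0 trace_Fp_add distrib_right)

text \<open>The trace is a nonzero polynomial function of degree at most p^(r-1) < q, so it cannot
  vanish on the whole field.\<close>

lemma ex_trace_nonzero: "\<exists>x. tr_f x \<noteq> 0"
proof -
  have r: "r > 0"
  proof (rule ccontr)
    assume "\<not> r > 0"
    then have "card {0, 1 :: 'a} \<le> 1" using card_mono[of UNIV "{0, 1 :: 'a}"] card_a by simp
    then show False by simp
  qed
  have p1: "p > 1" using p by (rule prime_gt_1_nat)
  define f :: "'a poly" where "f = (\<Sum>i<r. monom 1 (p ^ i))"
  have "coeff f (p ^ (r - 1)) = (\<Sum>i<r. if i = r - 1 then 1 else 0)"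
    unfolding f_def coeff_sum coeff_monom using p1 by (intro sum.cong) auto
  also have "\<dots> = 1" using r by (simp add: sum.delta')
  finally have f0: "f \<noteq> 0" by auto
  have "degree f \<le> p ^ (r - 1)"
    unfolding f_def using p1 by (intro degree_sum_le) (auto simp: degree_monom_eq intro!: power_increasing)
  also have "\<dots> < CARD('a)" using p1 r by (simp add: card_a)
  finally have "card {x. poly f x = 0} < CARD('a)"
    using card_poly_roots_bound[OF f0] by linarith
  then have "\<exists>x. poly f x \<noteq> 0" by (metis (mono_tags, lifting) UNIV_eq_I less_irrefl mem_Collect_eq)
  moreover have "poly f x = tr x" for x by (simp add: f_def tr_def poly_sum poly_monom)
  ultimately obtain x where x: "tr x \<noteq> 0" by auto
  obtain k where "of_int k = tr x" "tr_f x = of_int k" by (rule trace_Fp_witness)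
  then show ?thesis using x of_int_eq_iff_transfer[of k 0] by (intro exI[of _ x]) auto
qed

lemma surj_trace_Fp: "\<exists>x. tr_f x = y"
proof -
  obtain x where x: "tr_f x \<noteq> 0" using ex_trace_nonzero by blast
  obtain k :: nat where "y / tr_f x = of_nat k"
    using ex_of_nat_prime_field[where 'f = 'f] p card_f by metis
  then have "tr_f (of_nat k * x) = y" using x by (simp add: trace_Fp_of_nat divide_eq_eq)
  then show ?thesis by blast
qed

text \<open>Translating the summation variable by an x of nontrivial character value multiplies the
  sum by a number other than 1.\<close>

lemma sum_character:
  fixes \<eta>\<^sub>0 :: "'f \<Rightarrow> complex"
  assumes \<eta>: "nontrivial_additive_character \<eta>\<^sub>0"
  shows "(\<Sum>a\<in>UNIV. \<eta>\<^sub>0 (tr_f a)) = 0"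
proof -
  obtain y where "\<eta>\<^sub>0 y \<noteq> 1" using \<eta> by (auto simp: nontrivial_additive_character_def)
  then obtain x :: 'a where x: "\<eta>\<^sub>0 (tr_f x) \<noteq> 1" using surj_trace_Fp[of y] by blast
  let ?S = "\<Sum>a\<in>UNIV. \<eta>\<^sub>0 (tr_f a)"
  have "?S = (\<Sum>a\<in>UNIV. \<eta>\<^sub>0 (tr_f (x + a)))"
    by (rule sum.reindex_bij_witness[where i = "\<lambda>a. x + a" and j = "\<lambda>a. a - x"]) auto
  also have "\<dots> = \<eta>\<^sub>0 (tr_f x) * ?S"
    using \<eta> by (simp add: trace_Fp_add nontrivial_additive_character_def sum_distrib_left)
  finally show ?thesis using x by simp
qed

end

section \<open>The Hecke operators modulo $p$\<close>

context cuspidal_cochain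
begin

text \<open>By \<open>c1_of_int\<close> this is -c_1 of the sum of the T_p F over all p of degree
  j.\<close>

definition level_sum :: "nat \<Rightarrow> int" where
  "level_sum j = (\<Sum>m | monic m \<and> degree m = j. hecke N (principal_ideal m) F (edge_at 2 fls_X))"

lemma level_sum_eq:
  "level_sum j = (\<Sum>v\<in>polys_below (Suc j). int (card (hit v j)) * E (int j + 2) (fls_X_intpow (int j + 1) * of_A v))"
proof -
  let ?M = "{m :: 'a poly. monic m \<and> degree m = j}" and ?V = "polys_below (Suc j) :: 'a poly set"
  let ?h = "\<lambda>v. E (int j + 2) (fls_X_intpow (int j + 1) * of_A v)"
  have finM: "finite ?M" by (rule finite_subset[OF _ finite_monic_degree[of j]]) auto
  have "hecke N (principal_ideal m) F (edge_at 2 fls_X) = (\<Sum>v\<in>?V. if coeff (v * m) j = 1 then ?h v else 0)"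
    if "m \<in> ?M" for m
  proof -
    have "hecke N (principal_ideal m) F (edge_at 2 fls_X) = (\<Sum>b\<in>polys_below j. E (int j + 2) ((fls_X + of_A b) / of_A m))"
      using that by (simp add: hecke_at_base_edge ac_simps)
    also have "\<dots> = (\<Sum>v | v \<in> ?V \<and> coeff (v * m) j = 1. ?h v)"
      using that by (intro sum_fractions E_cong) auto
    also have "\<dots> = (\<Sum>v\<in>?V. if coeff (v * m) j = 1 then ?h v else 0)"
      using sum.inter_filter[of ?V ?h "\<lambda>v. coeff (v * m) j = 1"] by simp
    finally show ?thesis .
  qed
  then have "level_sum j = (\<Sum>m\<in>?M. \<Sum>v\<in>?V. if coeff (v * m) j = 1 then ?h v else 0)"
    unfolding level_sum_def by (rule sum.cong[OF refl])
  also have "\<dots> = (\<Sum>v\<in>?V. \<Sum>m\<in>?M. if coeff (v * m) j = 1 then ?h v else 0)"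
    by (rule sum.swap)
  also have "\<dots> = (\<Sum>v\<in>?V. int (card (hit v j)) * ?h v)"
  proof (rule sum.cong[OF refl])
    fix v
    have "hit v j = {m \<in> ?M. coeff (v * m) j = 1}" by (auto simp: hit_def)
    then show "(\<Sum>m\<in>?M. if coeff (v * m) j = 1 then ?h v else 0) = int (card (hit v j)) * ?h v"
      using sum.inter_filter[OF finM, of "\<lambda>m. ?h v" "\<lambda>m. coeff (v * m) j = 1"] by simp
  qed
  finally show ?thesis .
qed

lemma level_sum_ge_2: "j \<ge> 2 \<Longrightarrow> int CARD('a) dvd level_sum j"
  unfolding level_sum_eq by (intro dvd_sum dvd_mult2) (simp add: card_hit_dvd)

lemma level_sum_0: "level_sum 0 = E 2 fls_X"
proof -
  have "{m :: 'a poly. monic m \<and> degree m = 0} = {1}"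
    by (auto simp: monic_def one_pCons elim!: degree_eq_zeroE)
  then show ?thesis
    by (simp add: level_sum_def hecke_at_base_edge monic_def)
qed

text \<open>Here v = t + s T and u = s pi + t pi^2. Modulo q exactly the v with s nonzero count,
  each once. Summing over t returns to level 2 by harmonicity, and E 2 (s pi) = E 2 pi for each of
  the q - 1 values of s.\<close>

lemma level_sum_1: "int CARD('a) dvd level_sum 1 - (int CARD('a) - 1) * E 2 fls_X"
proof -
  let ?h = "\<lambda>v. E 3 (fls_X_intpow 2 * of_A v)"
  have "(\<Sum>v\<in>polys_below (Suc 1). g v) = (\<Sum>s\<in>UNIV. \<Sum>t\<in>UNIV. g [:t, s:])" for g :: "'a poly \<Rightarrow> int"
  proof -
    have "monom t 0 + monom s 1 = [:t, s:]" for s t :: 'a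
      by (simp add: monom_0 monom_Suc)
    then show ?thesis unfolding sum_polys_below_Suc One_nat_def by (simp add: sum_polys_below_Suc)
  qed
  then have 1: "level_sum 1 = (\<Sum>s\<in>UNIV. \<Sum>t\<in>UNIV. int (card (hit [:t, s:] 1)) * ?h [:t, s:])"
    unfolding level_sum_eq by simp
  have 2: "(\<Sum>t\<in>UNIV. (if s = 0 then 0 else 1) * ?h [:t, s:]) = (if s = 0 then 0 else E 2 fls_X)" for s
  proof (cases "s = 0")
    case False
    have "fls_X_intpow 2 * of_A [:t, s:] = fls_const s * fls_X + fls_const t * fls_X_intpow 2" for t
    proof -
      have "fls_X_intpow 2 * fls_X_inv = (fls_X :: 'a fls)"
        by (simp add: fls_X_inv_times_conv_shift fls_X_conv_shift_1 mult.commute)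
      then show ?thesis
        by (simp add: of_A_pCons algebra_simps)
    qed
    then have "(\<Sum>t\<in>UNIV. ?h [:t, s:]) = E 2 (fls_const s * fls_X)"
      by (simp add: E_harmonic[of 2])
    then show ?thesis using False by (simp add: E_const_mult)
  qed simp
  have "(\<Sum>s\<in>UNIV. \<Sum>t\<in>UNIV. (if s = 0 then 0 else 1) * ?h [:t, s:]) = (\<Sum>s\<in>UNIV - {0 :: 'a}. E 2 fls_X)"
    unfolding 2 by (subst sum.remove[of _ 0]) auto
  also have "\<dots> = (int CARD('a) - 1) * E 2 fls_X" by simp
  finally have 3: "(int CARD('a) - 1) * E 2 fls_X = (\<Sum>s\<in>UNIV. \<Sum>t\<in>UNIV. (if s = 0 then 0 else 1) * ?h [:t, s:])" ..
  have "level_sum 1 - (int CARD('a) - 1) * E 2 fls_X =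
     (\<Sum>s\<in>UNIV. \<Sum>t\<in>UNIV. (int (card (hit [:t, s:] 1)) - (if s = 0 then 0 else 1)) * ?h [:t, s:])"
    unfolding 1 3 by (simp only: left_diff_distrib sum_subtractf)
  also have "int CARD('a) dvd \<dots>"
    by (intro dvd_sum dvd_mult2 card_hit_linear)
  finally show ?thesis .
qed

lemma sum_hecke_degree_eq:
  assumes "d \<ge> 2"
  shows "int CARD('a) dvd (\<Sum>P | nonzero_ideal P \<and> ideal_degree P = d. hecke N P F (edge_at 2 fls_X))"
  using level_sum_ge_2[OF assms]
    sum.reindex_bij_betw[OF bij_betw_principal_ideal[where R = "\<lambda>k. k = d"], of "\<lambda>P. hecke N P F (edge_at 2 fls_X)"]
  by (simp add: level_sum_def)

lemma sum_hecke_degree_le: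
  assumes "d \<ge> 1"
  shows "int CARD('a) dvd (\<Sum>P | nonzero_ideal P \<and> ideal_degree P \<le> d. hecke N P F (edge_at 2 fls_X))"
proof -
  have "(\<Sum>P | nonzero_ideal P \<and> ideal_degree P \<le> d. hecke N P F (edge_at 2 fls_X)) =
      (\<Sum>m | monic m \<and> degree m \<le> d. hecke N (principal_ideal m) F (edge_at 2 fls_X))"
    using sum.reindex_bij_betw[OF bij_betw_principal_ideal[where R = "\<lambda>k. k \<le> d"], of "\<lambda>P. hecke N P F (edge_at 2 fls_X)"]
    by simp
  also have "\<dots> = (\<Sum>j\<le>d. level_sum j)"
    unfolding level_sum_def using finite_monic_degree[of d]
    by (subst sum.group[symmetric, where T = "{..d}" and g = degree]) (auto intro!: sum.cong)
  also have "\<dots> = level_sum 0 + level_sum 1 + (\<Sum>j\<in>{2..d}. level_sum j)"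
  proof -
    have "{..d} = insert 0 (insert 1 {2..d})" using assms by auto
    then show ?thesis by simp
  qed
  \<comment> \<open>Level 0 contributes E 2 pi; together with the main part (q - 1) E 2 pi of level
    1 this makes a multiple of q.\<close>
  also have "\<dots> = int CARD('a) * E 2 fls_X + (level_sum 1 - (int CARD('a) - 1) * E 2 fls_X) + (\<Sum>j\<in>{2..d}. level_sum j)"
    by (simp add: level_sum_0 algebra_simps)
  also have "int CARD('a) dvd \<dots>"
    by (intro dvd_add dvd_triv_left level_sum_1 dvd_sum level_sum_ge_2) simp
  finally show ?thesis .
qed

end

section \<open>The coefficient $c_1$\<close>

text \<open>At level 2 the value is Y at 0 and X at a pi for each nonzero a. Harmonicity from level
  1, where values vanish, gives Y = -(q - 1) X. In c_1 the character sum kills the constant part X,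
  leaving (Y - X)/q = -X.\<close>

lemma c1_of_int:
  fixes N :: "'a::finite_field poly set" and \<eta>\<^sub>0 :: "'f::finite_field \<Rightarrow> complex"
  assumes p: "prime p" "CARD('a) = p ^ r" "CARD('f) = p" and \<eta>: "nontrivial_additive_character \<eta>\<^sub>0"
    and N: "nonzero_ideal N" and F: "F \<in> H0 N"
  shows "c1 \<eta>\<^sub>0 (\<lambda>e. of_int (F e)) = - of_int (F (edge_at 2 fls_X))"
proof -
  interpret cuspidal_cochain N F using N F by unfold_locales
  interpret trace_to_prime_field p r "TYPE('a)" "TYPE('f)" using p by unfold_locales
  define X Y where "X = E 2 fls_X" and "Y = E 2 0"
  have E2: "E 2 (fls_const a * fls_X) = (if a = 0 then Y else X)" for a
    by (simp add: X_def Y_def E_const_mult)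
  have "(0 :: int) = (\<Sum>a\<in>UNIV. E 2 (fls_const a * fls_X))"
    using E_harmonic[of 1 0] by (simp add: E_eq_0 fls_X_conv_shift_1)
  also have "\<dots> = Y + (int CARD('a) - 1) * X"
    unfolding E2 by (subst sum.remove[of _ 0]) auto
  finally have XY: "Y = X - int CARD('a) * X" by (simp add: algebra_simps)
  have inj: "inj (\<lambda>a :: 'a. fls_const a * fls_X)"
  proof
    fix x y :: 'a assume "fls_const x * fls_X = fls_const y * fls_X"
    from arg_cong[OF this, of "\<lambda>f. fls_nth f 1"] show "x = y" by simp
  qed
  have "c1 \<eta>\<^sub>0 (\<lambda>e. of_int (F e)) = inverse (of_nat CARD('a)) *
      (\<Sum>a\<in>UNIV. of_int (E 2 (fls_const a * fls_X)) * \<eta>\<^sub>0 (tr_f (- a)))"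
    unfolding c1_def sum.reindex[OF inj] edge_at_def eta_def
    by (simp add: fls_X_power_conv_shift_1[of 2])
  also have "(\<Sum>a\<in>UNIV. of_int (E 2 (fls_const a * fls_X)) * \<eta>\<^sub>0 (tr_f (- a))) =
      (\<Sum>a\<in>UNIV. of_int X * \<eta>\<^sub>0 (tr_f (- a)) + (if a = 0 then of_int (Y - X) * \<eta>\<^sub>0 (tr_f (- a)) else 0))"
    unfolding E2 by (intro sum.cong) (auto simp: algebra_simps)
  also have "\<dots> = of_int X * (\<Sum>a\<in>UNIV. \<eta>\<^sub>0 (tr_f (- a))) + of_int (Y - X) * \<eta>\<^sub>0 (tr_f 0)"
    by (simp add: sum.distrib sum_distrib_left)
  also have "(\<Sum>a\<in>UNIV. \<eta>\<^sub>0 (tr_f (- a))) = (\<Sum>a\<in>UNIV. \<eta>\<^sub>0 (tr_f a))"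
    by (rule sum.reindex_bij_witness[where i = uminus and j = uminus]) auto
  also have "\<dots> = 0" by (rule sum_character[OF \<eta>])
  also have "\<eta>\<^sub>0 (tr_f 0) = 1"
  proof -
    have "\<eta>\<^sub>0 0 * \<eta>\<^sub>0 0 = \<eta>\<^sub>0 0" "\<eta>\<^sub>0 0 \<noteq> 0"
      using \<eta> unfolding nontrivial_additive_character_def by (metis add_0)+
    then show ?thesis by (simp add: trace_Fp_0)
  qed
  finally show ?thesis by (simp add: XY X_def)
qed

text \<open>Two integral lifts of the same cochain agree modulo p at the base edge, so the
  \<open>THE\<close> in \<open>c1_mod\<close> does not depend on the lift.\<close>

lemma c1_mod_of_int:
  fixes N :: "'a::finite_field poly set" and \<eta>\<^sub>0 :: "'f::finite_field \<Rightarrow> complex"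
  assumes p: "prime p" "CARD('a) = p ^ r" "CARD('f) = p" and \<eta>: "nontrivial_additive_character \<eta>\<^sub>0"
    and N: "nonzero_ideal N" and F: "F \<in> H0 N"
  shows "c1_mod \<eta>\<^sub>0 N (\<lambda>e. of_int (F e)) = - of_int (F (edge_at 2 fls_X))"
proof -
  have c1_int: "c1_int \<eta>\<^sub>0 F = - F (edge_at 2 fls_X)" if "F \<in> H0 N" for F :: "'a edge \<Rightarrow> int"
    unfolding c1_int_def c1_of_int[OF p \<eta> N that] by (rule the_equality) (simp_all flip: of_int_minus)
  show ?thesis
    unfolding c1_mod_def
  proof (rule the_equality)
    show "\<exists>F'\<in>H0 N. (\<lambda>e. of_int (F e)) = (\<lambda>e. of_int (F' e) :: 'f) \<and>
        - of_int (F (edge_at 2 fls_X)) = (of_int (c1_int \<eta>\<^sub>0 F') :: 'f)"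
      using F by (intro bexI[of _ F]) (simp_all add: c1_int)
  next
    fix x :: 'f assume "\<exists>F'\<in>H0 N. (\<lambda>e. of_int (F e)) = (\<lambda>e. of_int (F' e) :: 'f) \<and> x = of_int (c1_int \<eta>\<^sub>0 F')"
    then obtain F' where F': "F' \<in> H0 N" "\<And>e. of_int (F e) = (of_int (F' e) :: 'f)" "x = of_int (c1_int \<eta>\<^sub>0 F')"
      by (auto simp: fun_eq_iff)
    show "x = - of_int (F (edge_at 2 fls_X))" using F'(1,3) by (simp add: c1_int F'(2))
  qed
qed

text \<open>Every element of F_p is the image of an integer, so a sum of tensors collapses to a
  single integral cochain.\<close>

lemma H00_lift:
  assumes p: "prime CARD('f)" and G: "(G :: 'a::{field, finite} edge \<Rightarrow> 'f::finite_field) \<in> H00 N"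
  obtains F where "F \<in> H0 N" "G = (\<lambda>e. of_int (F e))"
proof -
  obtain m :: nat and s and Fs where *: "\<forall>i<m. Fs i \<in> H0 N" "G = (\<lambda>e. \<Sum>i<m. s i * of_int (Fs i e))"
    using G unfolding H00_def by blast
  have "\<forall>i. \<exists>k. s i = of_nat k" using ex_of_nat_prime_field[OF p] by blast
  then obtain k where k: "\<And>i. s i = of_nat (k i)" by metis
  have "(\<lambda>e. \<Sum>i<m. int (k i) * Fs i e) \<in> H0 N" using *(1) by (intro H0_sum) simp
  moreover have "G = (\<lambda>e. of_int (\<Sum>i<m. int (k i) * Fs i e))" by (simp add: *(2) k)
  ultimately show thesis using that by blast
qed

section \<open>The left kernel\<close>

lemma sum_T_op_hecke_algebra:
  assumes "finite \<P>" "\<And>P. P \<in> \<P> \<Longrightarrow> nonzero_ideal P"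
  shows "(\<Sum>P\<in>\<P>. T_op N P) \<in> (hecke_algebra N :: (('a::field edge \<Rightarrow> 'r::comm_ring_1) \<Rightarrow> _) set)"
  using assms
proof (induction \<P>)
  case empty
  \<comment> \<open>The zero operator is obtained as 0 times the identity.\<close>
  have "(\<lambda>F e. 0 * on_H00 N (\<lambda>F. F) F e) \<in> (hecke_algebra N :: (('a edge \<Rightarrow> 'r) \<Rightarrow> _) set)"
    by (intro hecke_algebra.scale hecke_algebra.one)
  then show ?case by (simp add: zero_fun_def)
next
  case (insert P \<P>)
  then show ?case
    unfolding sum.insert[OF insert.hyps] by (intro hecke_algebra.add hecke_algebra.gen) simp_all
qed

lemma hecke_of_int: "hecke N P (\<lambda>e. of_int (F e)) = (\<lambda>e. of_int (hecke N P F e))"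
  by (simp add: hecke_def)

lemma sum_T_op_in_left_kernel:
  fixes N :: "'a::finite_field poly set" and \<eta>\<^sub>0 :: "'f::finite_field \<Rightarrow> complex"
  assumes p: "prime p" "CARD('a) = p ^ r" "CARD('f) = p" and \<eta>: "nontrivial_additive_character \<eta>\<^sub>0"
    and N: "nonzero_ideal N"
    and \<P>: "finite \<P>" "\<And>P. P \<in> \<P> \<Longrightarrow> nonzero_ideal P"
    and dvd: "\<And>F. F \<in> H0 N \<Longrightarrow> int CARD('a) dvd (\<Sum>P\<in>\<P>. hecke N P F (edge_at 2 fls_X))"
  shows "(\<Sum>P\<in>\<P>. T_op N P) \<in> left_kernel (hecke_algebra N) (H00 N) (pairing_HC \<eta>\<^sub>0 N)"
proof -
  have "pairing_HC \<eta>\<^sub>0 N (\<Sum>P\<in>\<P>. T_op N P) G = 0" if G: "G \<in> H00 N" for G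
  proof -
    obtain F where F: "F \<in> H0 N" "G = (\<lambda>e. of_int (F e))"
      using G H00_lift p by metis
    \<comment> \<open>The factor 1 matches the shape of the linear combinations in
      \<open>H0_sum\<close>.\<close>
    let ?F = "\<lambda>e. \<Sum>P\<in>\<P>. 1 * hecke N P F e"
    have sum_apply: "(\<Sum>P\<in>\<P>. T_op N P) G e = (\<Sum>P\<in>\<P>. T_op N P G e)" for e
      using \<P>(1) by (induction \<P>) (simp_all add: zero_fun_def)
    have "(\<Sum>P\<in>\<P>. T_op N P) G = (\<lambda>e. of_int (?F e))"
    proof
      fix e
      have "T_op N P G e = of_int (hecke N P F e)" for P
        using G unfolding T_op_def on_H00_def by (simp add: F(2) hecke_of_int)
      then show "(\<Sum>P\<in>\<P>. T_op N P) G e = of_int (?F e)" by (simp add: sum_apply)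
    qed
    moreover have "?F \<in> H0 N" by (intro H0_sum hecke_H0 N F(1) \<P>(2))
    ultimately have "pairing_HC \<eta>\<^sub>0 N (\<Sum>P\<in>\<P>. T_op N P) G = - of_int (?F (edge_at 2 fls_X))"
      unfolding pairing_HC_def by (simp only: c1_mod_of_int[OF p \<eta> N])
    also have "of_int (?F (edge_at 2 fls_X)) = (0 :: 'f)"
    proof -
      have "int p dvd int CARD('a)"
      proof -
        \<comment> \<open>A field has at least two elements, so q is not 1 and p divides q.\<close>
        have "r \<noteq> 0" using p(2) card_mono[of UNIV "{0, 1 :: 'a}"] by (intro notI) simp
        then show ?thesis using p(2) by simp
      qed
      then have "int p dvd ?F (edge_at 2 fls_X)"
        using dvd_trans[OF _ dvd[OF F(1)]] by simp
      moreover have "CHAR('f) = p" using CHAR_finite_field[OF p(1), where r = 1 and 'a = 'f] p(3) by simp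
      ultimately show ?thesis by (simp only: of_int_eq_0_iff_char_dvd)
    qed
    finally show ?thesis by simp
  qed
  then show ?thesis
    using sum_T_op_hecke_algebra[OF \<P>] by (simp add: left_kernel_def)
qed

lemma finite_ideals_degree_le: "finite {P :: 'a::{field, finite} poly set. nonzero_ideal P \<and> ideal_degree P \<le> d}"
  using bij_betw_finite[OF bij_betw_principal_ideal[where R = "\<lambda>k. k \<le> d" and 'a = 'a]] finite_monic_degree by blast

theorem proposition4p8:
  fixes p r :: nat
    and N :: "'a::finite_field poly set"
    and \<eta>\<^sub>0 :: "'f::finite_field \<Rightarrow> complex"
  assumes "prime p" and "CARD('a) = p ^ r" and "CARD('f) = p"
    and "nonzero_ideal N"
    and "nontrivial_additive_character \<eta>\<^sub>0"
  shows "(\<forall>d\<ge>1. (\<Sum>P | nonzero_ideal P \<and> ideal_degree P \<le> d. T_op N P)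
             \<in> left_kernel (hecke_algebra N) (H00 N) (pairing_HC \<eta>\<^sub>0 N)) \<and>
         (\<forall>d\<ge>2. (\<Sum>P | nonzero_ideal P \<and> ideal_degree P = d. T_op N P)
             \<in> left_kernel (hecke_algebra N) (H00 N) (pairing_HC \<eta>\<^sub>0 N))"
proof (intro conjI allI impI)
  have cochain: "cuspidal_cochain N F" if "F \<in> H0 N" for F
    using that assms(4) by unfold_locales
  fix d :: nat
  {
    assume "d \<ge> 1"
    then show "(\<Sum>P | nonzero_ideal P \<and> ideal_degree P \<le> d. T_op N P)
             \<in> left_kernel (hecke_algebra N) (H00 N) (pairing_HC \<eta>\<^sub>0 N)"
      using finite_ideals_degree_le cuspidal_cochain.sum_hecke_degree_le[OF cochain]
      by (intro sum_T_op_in_left_kernel[OF assms(1-3,5,4)]) auto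
  next
    assume "d \<ge> 2"
    moreover have "finite {P :: 'a poly set. nonzero_ideal P \<and> ideal_degree P = d}"
      by (rule finite_subset[OF _ finite_ideals_degree_le[of d]]) auto
    ultimately show "(\<Sum>P | nonzero_ideal P \<and> ideal_degree P = d. T_op N P)
             \<in> left_kernel (hecke_algebra N) (H00 N) (pairing_HC \<eta>\<^sub>0 N)"
      using cuspidal_cochain.sum_hecke_degree_eq[OF cochain]
      by (intro sum_T_op_in_left_kernel[OF assms(1-3,5,4)]) auto
  }
qed

end
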